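(* For a semigroup $X$ the following conditions are equivalent: (1) $\varphi(X)$ is a commutative Clifford semigroup; (2) $\varphi(X)$ is an inverse semigroup; (3) the idempotents of the semigroup $\varphi(X)$ commute, and $\varphi(X)$ is sub-Clifford or $\varphi(X)$ is regular in $N_2(X)$; (4) $X$ is isomorphic to one of the semigroups $C_2$, $L_n$, or $L_n\sqcup C_2$ for some $n\in\omega$.
   Context: An upfamily on a set $X$ is a family $\mathcal F$ of nonempty subsets of $X$ such that $F\in\mathcal F$ and $F\subset E\subset X$ imply $E\in\mathcal F$. $\upsilon(X)$ is the set of all upfamilies on $X$. An upfamily $\mathcal F$ is linked if $A\cap B\neq\emptyset$ for all $A,B\in\mathcal F$, and a filter if $A\cap B\in\mathcal F$ for all $A,B\in\mathcal F$. $N_2(X)$ and $\varphi(X)$ denote the sets of linked upfamilies and of filters on $X$. Each $x\in X$ is identified with $\langle x\rangle=\{A\subset X: x\in A\}$. For a family $\mathcal C$ of nonempty subsets, $\langle\mathcal C\rangle=\{A\subset X:\exists C\in\mathcal C,\ C\subset A\}$. For a semigroup $(X,* )$ the operation is extended to $\upsilon(X)$ by $\mathcal A*\mathcal B=\big\langle \bigcup_{a\in A} a*B_a : A\in\mathcal A,\ \{B_a\}_{a\in A}\subset\mathcal B\big\rangle$; $N_2(X)$ and $\varphi(X)$ are subsemigroups of $\upsilon(X)$. A semigroup $S$ is inverse if each $x$ has a unique $x^{-1}$ with $xx^{-1}x=x$, $x^{-1}xx^{-1}=x^{-1}$; Clifford if it is a union of groups; sub-Clifford if it is a union of cancellative subsemigroups.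 A subsemigroup $X\subset Y$ is regular in $Y$ if each $x\in X$ satisfies $x\in xYx$. $C_n=\{z\in\mathbb C: z^n=1\}$; $L_n=\{0,\dots,n-1\}$ with the operation $\min$ ($L_0=\emptyset$). For semigroups $(X,* )$, $(Y,\star)$, the disjoint ordered union $X\sqcup Y$ is the disjoint union with operation $x\circ y=x*y$ for $x,y\in X$; $x\circ y=x$ if $x\in X,y\in Y$; $x\circ y=y$ if $x\in Y,y\in X$; $x\circ y=x\star y$ for $x,y\in Y$. *)

theory Defs
  imports Complex_Main
begin

definition semigroup_on :: "'a set \<Rightarrow> ('a \<Rightarrow> 'a \<Rightarrow> 'a) \<Rightarrow> bool" where
  "semigroup_on S m \<longleftrightarrow> (\<forall>x\<in>S. \<forall>y\<in>S. m x y \<in> S) \<and>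
     (\<forall>x\<in>S. \<forall>y\<in>S. \<forall>z\<in>S. m (m x y) z = m x (m y z))"

definition sg_iso :: "'a set \<Rightarrow> ('a \<Rightarrow> 'a \<Rightarrow> 'a) \<Rightarrow> 'b set \<Rightarrow> ('b \<Rightarrow> 'b \<Rightarrow> 'b) \<Rightarrow> bool" where
  "sg_iso S m T n \<longleftrightarrow> (\<exists>h. bij_betw h S T \<and> (\<forall>x\<in>S. \<forall>y\<in>S. h (m x y) = n (h x) (h y)))"

definition commutative_on :: "'a set \<Rightarrow> ('a \<Rightarrow> 'a \<Rightarrow> 'a) \<Rightarrow> bool" where
  "commutative_on S m \<longleftrightarrow> (\<forall>x\<in>S. \<forall>y\<in>S. m x y = m y x)"

definition is_subgroup_on :: "'a set \<Rightarrow> ('a \<Rightarrow> 'a \<Rightarrow> 'a) \<Rightarrow> bool" where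
  "is_subgroup_on G m \<longleftrightarrow> (\<forall>x\<in>G. \<forall>y\<in>G. m x y \<in> G) \<and>
     (\<exists>e\<in>G. (\<forall>g\<in>G. m e g = g \<and> m g e = g) \<and> (\<forall>g\<in>G. \<exists>h\<in>G. m g h = e \<and> m h g = e))"

definition clifford_on :: "'a set \<Rightarrow> ('a \<Rightarrow> 'a \<Rightarrow> 'a) \<Rightarrow> bool" where
  "clifford_on S m \<longleftrightarrow> (\<forall>x\<in>S. \<exists>G. G \<subseteq> S \<and> x \<in> G \<and> is_subgroup_on G m)"

definition cancellative_subsemigroup :: "'a set \<Rightarrow> ('a \<Rightarrow> 'a \<Rightarrow> 'a) \<Rightarrow> bool" where
  "cancellative_subsemigroup T m \<longleftrightarrow> (\<forall>x\<in>T. \<forall>y\<in>T. m x y \<in> T) \<and>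
     (\<forall>a\<in>T. \<forall>b\<in>T. \<forall>c\<in>T. (m a b = m a c \<longrightarrow> b = c) \<and> (m b a = m c a \<longrightarrow> b = c))"

definition sub_clifford_on :: "'a set \<Rightarrow> ('a \<Rightarrow> 'a \<Rightarrow> 'a) \<Rightarrow> bool" where
  "sub_clifford_on S m \<longleftrightarrow> (\<forall>x\<in>S. \<exists>T. T \<subseteq> S \<and> x \<in> T \<and> cancellative_subsemigroup T m)"

definition inverse_on :: "'a set \<Rightarrow> ('a \<Rightarrow> 'a \<Rightarrow> 'a) \<Rightarrow> bool" where
  "inverse_on S m \<longleftrightarrow> (\<forall>x\<in>S. \<exists>!y. y \<in> S \<and> m (m x y) x = x \<and> m (m y x) y = y)"

definition idempotents_commute :: "'a set \<Rightarrow> ('a \<Rightarrow> 'a \<Rightarrow> 'a) \<Rightarrow> bool" where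
  "idempotents_commute S m \<longleftrightarrow>
     (\<forall>e\<in>S. \<forall>g\<in>S. m e e = e \<longrightarrow> m g g = g \<longrightarrow> m e g = m g e)"

definition regular_in :: "'a set \<Rightarrow> 'a set \<Rightarrow> ('a \<Rightarrow> 'a \<Rightarrow> 'a) \<Rightarrow> bool" where
  "regular_in S Y m \<longleftrightarrow> (\<forall>x\<in>S. \<exists>y\<in>Y. m (m x y) x = x)"

definition upfamily :: "'a set \<Rightarrow> 'a set set \<Rightarrow> bool" where
  "upfamily X F \<longleftrightarrow> (\<forall>A\<in>F. A \<noteq> {} \<and> A \<subseteq> X) \<and>
     (\<forall>A\<in>F. \<forall>E. A \<subseteq> E \<and> E \<subseteq> X \<longrightarrow> E \<in> F)"

definition upfamilies :: "'a set \<Rightarrow> 'a set set set" where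
  "upfamilies X = {F. upfamily X F}"

definition linked_upfamilies :: "'a set \<Rightarrow> 'a set set set" where
  "linked_upfamilies X = {F \<in> upfamilies X. \<forall>A\<in>F. \<forall>B\<in>F. A \<inter> B \<noteq> {}}"

definition filters :: "'a set \<Rightarrow> 'a set set set" where
  "filters X = {F \<in> upfamilies X. \<forall>A\<in>F. \<forall>B\<in>F. A \<inter> B \<in> F}"

definition ext_op :: "'a set \<Rightarrow> ('a \<Rightarrow> 'a \<Rightarrow> 'a) \<Rightarrow> 'a set set \<Rightarrow> 'a set set \<Rightarrow> 'a set set" where
  "ext_op X m \<A> \<B> = {E. E \<subseteq> X \<and> (\<exists>A\<in>\<A>. \<exists>Bs. (\<forall>a\<in>A. Bs a \<in> \<B>) \<and>
       (\<Union>a\<in>A. m a ` Bs a) \<subseteq> E)}"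

definition C_n :: "nat \<Rightarrow> complex set" where
  "C_n n = {z. z ^ n = 1}"

definition L_n :: "nat \<Rightarrow> nat set" where
  "L_n n = {..<n}"

text \<open>Disjoint ordered union of (X,m) and (Y,n): elements of X below those of Y.\<close>
definition ord_union_carrier :: "'a set \<Rightarrow> 'b set \<Rightarrow> ('a + 'b) set" where
  "ord_union_carrier X Y = Inl ` X \<union> Inr ` Y"

fun ord_union_op :: "('a \<Rightarrow> 'a \<Rightarrow> 'a) \<Rightarrow> ('b \<Rightarrow> 'b \<Rightarrow> 'b) \<Rightarrow> ('a + 'b) \<Rightarrow> ('a + 'b) \<Rightarrow> ('a + 'b)" where
  "ord_union_op m n (Inl x) (Inl y) = Inl (m x y)"
| "ord_union_op m n (Inl x) (Inr y) = Inl x"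
| "ord_union_op m n (Inr x) (Inl y) = Inl y"
| "ord_union_op m n (Inr x) (Inr y) = Inr (n x y)"

end

theory Submission
  imports Defs "HOL-Library.Ramsey"
begin

text \<open>The idea of (3) \<open>\<Longrightarrow>\<close> (4). The principal filters form a copy of the nonempty subsets of \<open>X\<close> under
  the setwise product. If the filter semigroup is sub-Clifford, then \<open>A A A = A A\<close> forces
  \<open>A A = A\<close>; if it is regular in \<open>N\<^sub>2(X)\<close>, then any two \<open>a, a' \<in> A\<close> admit one \<open>y\<close> with
  \<open>a y A \<subseteq> A\<close> and \<open>a' y A \<subseteq> A\<close>. Either property, tested on \<open>A = {e, f}\<close>, \<open>A = G - {1}\<close> and
  \<open>A = {x, f}\<close>, shows that the idempotents form a chain, that subgroups of \<open>X\<close> have at most two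
  elements, and that a nontrivial one sits over the largest idempotent. The chain is finite
  because the even and the odd tails of an infinite monotone sequence of idempotents generate
  two idempotent filters that do not commute. Conversely, (4) yields a finite commutative \<open>X\<close>
  with \<open>x y z \<in> {x, y, z}\<close>, so that all filters are principal and satisfy \<open>F F F = F\<close>.
  The empty family also counts as a filter; it only adjoins a zero.\<close>

section \<open>Commutative Clifford semigroups, inverse semigroups and commuting idempotents\<close>

lemma sgD:
  assumes "semigroup_on S m"
  shows "x \<in> S \<Longrightarrow> y \<in> S \<Longrightarrow> m x y \<in> S"
    and "x \<in> S \<Longrightarrow> y \<in> S \<Longrightarrow> z \<in> S \<Longrightarrow> m (m x y) z = m x (m y z)"
  using assms unfolding semigroup_on_def by blast+

text \<open>The inverse of x inside a subgroup containing x serves. It is unique: for inverses y and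
  z of x, the product z x y equals z, and by commutativity it is also y x z = y.\<close>

lemma commutative_clifford_imp_inverse:
  assumes sg: "semigroup_on S m" and comm: "commutative_on S m" and cl: "clifford_on S m"
  shows "inverse_on S m"
  unfolding inverse_on_def
proof
  fix x assume x: "x \<in> S"
  note cl' = sgD(1)[OF sg] and as = sgD(2)[OF sg]
  have cm: "m a b = m b a" if "a \<in> S" "b \<in> S" for a b
    using comm that unfolding commutative_on_def by blast
  obtain G where G: "G \<subseteq> S" "x \<in> G" "is_subgroup_on G m"
    using cl x unfolding clifford_on_def by blast
  then obtain e y where e: "e \<in> G" "\<And>g. g \<in> G \<Longrightarrow> m e g = g \<and> m g e = g"
    and y: "y \<in> G" "m x y = e" "m y x = e"
    unfolding is_subgroup_on_def by metis
  show "\<exists>!y. y \<in> S \<and> m (m x y) x = x \<and> m (m y x) y = y"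
  proof (rule ex1I[of _ y])
    show "y \<in> S \<and> m (m x y) x = x \<and> m (m y x) y = y"
      using G e y by auto
  next
    fix z assume z: "z \<in> S \<and> m (m x z) x = x \<and> m (m z x) z = z"
    have yS: "y \<in> S" using y G by blast
    have exy: "m (m x y) x = x" "m (m y x) y = y" using G e y by auto
    \<comment> \<open>Expand the first \<open>a\<close> to a x a; commutativity then brings x b x
      together, which collapses to x.\<close>
    have key: "m a (m x b) = a"
      if "a \<in> S" "b \<in> S" "m (m x a) x = x" "m (m a x) a = a" "m (m x b) x = x" for a b
    proof -
      have "m a (m x b) = m (m (m a x) a) (m x b)" using that by simp
      also have "\<dots> = m (m a (m (m x b) x)) a"
        using that x by (metis as cm cl')
      also have "\<dots> = a" using that by simp
      finally show ?thesis .
    qed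
    have "z = m z (m x y)" using key[of z y] z yS exy by simp
    also have "\<dots> = m y (m x z)" using z yS x by (metis as cm cl')
    also have "\<dots> = y" using key[of y z] z yS exy by simp
    finally show "z = y" .
  qed
qed

text \<open>If x is an inverse of e f, then so is f x e; hence x = f x e, and this is idempotent.
  Now x and e f are both inverses of x, so products of idempotents are idempotent. Then e f and f e
  are both inverses of e f.\<close>

lemma inverse_imp_idempotents_commute:
  assumes sg: "semigroup_on S m" and inv: "inverse_on S m"
  shows "idempotents_commute S m"
proof -
  note cl = sgD(1)[OF sg] and as = sgD(2)[OF sg]
  have uniq: "y = z" if "x \<in> S" "y \<in> S" "z \<in> S" "m (m x y) x = x" "m (m y x) y = y"
    "m (m x z) x = x" "m (m z x) z = z" for x y z
    using inv that unfolding inverse_on_def by blast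
  have idem: "m (m e f) (m e f) = m e f"
    if e: "e \<in> S" "m e e = e" and f: "f \<in> S" "m f f = f" for e f
  proof -
    have ee: "m e (m e z) = m e z" and ff: "m f (m f z) = m f z" if "z \<in> S" for z
      using as[of e e z] as[of f f z] e f that by simp_all
    have efS: "m e f \<in> S" using e f cl by blast
    then obtain x where x: "x \<in> S" "m (m (m e f) x) (m e f) = m e f" "m (m x (m e f)) x = x"
      using inv unfolding inverse_on_def by blast
    have x1: "m e (m f (m x (m e f))) = m e f" and x2: "m x (m e (m f x)) = x"
      using x e f by (simp_all add: as cl)
    have x2': "m x (m e (m f (m x z))) = m x z" if "z \<in> S" for z
      using arg_cong[OF x2, of "\<lambda>u. m u z"] that x e f by (simp add: as cl)
    have "x = m f (m x e)"
      by (rule uniq[of "m e f"]) (use x e f in \<open>simp_all add: as cl ee ff x1 x2 x2'\<close>)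
    then have xx: "m x x = x" using x e f x2'[of e]
      by (metis as cl)
    have "m e f = x"
      by (rule uniq[of x]) (use x e f xx in \<open>simp_all add: as cl\<close>)
    then show ?thesis using xx by simp
  qed
  show ?thesis unfolding idempotents_commute_def
  proof (intro ballI impI)
    fix e f assume e: "e \<in> S" and f: "f \<in> S" and ee: "m e e = e" and ff: "m f f = f"
    have ee': "m e (m e z) = m e z" and ff': "m f (m f z) = m f z" if "z \<in> S" for z
      using as[of e e z] as[of f f z] e f ee ff that by simp_all
    have i1: "m e (m f (m e f)) = m e f" and i2: "m f (m e (m f e)) = m f e"
      using idem[OF e ee f ff] idem[OF f ff e ee] e f by (simp_all add: as cl)
    show "m e f = m f e"
      by (rule uniq[of "m e f"]) (use e f in \<open>simp_all add: as cl ee' ff' i1 i2\<close>)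
  qed
qed

section \<open>Families of sets and the extended operation\<close>

text \<open>Turns an Isabelle filter into a family of subsets of X, so that products can be computed
  with \<open>eventually\<close>.\<close>

definition lift :: "'a set \<Rightarrow> 'a filter \<Rightarrow> 'a set set" where
  "lift X \<Phi> = {E. E \<subseteq> X \<and> (\<forall>\<^sub>F x in \<Phi>. x \<in> E)}"

definition sprod :: "('a \<Rightarrow> 'a \<Rightarrow> 'a) \<Rightarrow> 'a set \<Rightarrow> 'a set \<Rightarrow> 'a set" where
  "sprod m A B = {m a b | a b. a \<in> A \<and> b \<in> B}"

lemma Ball_sprod: "(\<forall>x\<in>sprod m A B. P x) \<longleftrightarrow> (\<forall>a\<in>A. \<forall>b\<in>B. P (m a b))"
  unfolding sprod_def by blast

lemma lift_in_filters:
  assumes "\<Phi> \<noteq> bot"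
  shows "lift X \<Phi> \<in> filters X"
  unfolding filters_def upfamilies_def upfamily_def
proof (intro CollectI conjI ballI allI impI)
  fix A assume "A \<in> lift X \<Phi>"
  then have A: "A \<subseteq> X" "\<forall>\<^sub>F x in \<Phi>. x \<in> A" unfolding lift_def by auto
  show "A \<subseteq> X" by (rule A)
  show "A \<noteq> {}" using A assms by (auto simp: trivial_limit_def)
  show "E \<in> lift X \<Phi>" if "A \<subseteq> E \<and> E \<subseteq> X" for E
    using A that unfolding lift_def by (auto elim: eventually_mono)
  show "A \<inter> B \<in> lift X \<Phi>" if "B \<in> lift X \<Phi>" for B
    using A that unfolding lift_def by (auto simp: eventually_conj_iff)
qed

lemma filters_subset_linked: "filters X \<subseteq> linked_upfamilies X"
  by (auto simp: filters_def linked_upfamilies_def upfamilies_def upfamily_def)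

lemma linked_subset_upfamilies: "linked_upfamilies X \<subseteq> upfamilies X"
  unfolding linked_upfamilies_def by blast

lemma filters_subset_upfamilies: "filters X \<subseteq> upfamilies X"
  unfolding filters_def by blast

lemma upfamiliesD:
  assumes "F \<in> upfamilies X"
  shows "A \<in> F \<Longrightarrow> A \<subseteq> X" "A \<in> F \<Longrightarrow> A \<noteq> {}" "A \<in> F \<Longrightarrow> A \<subseteq> E \<Longrightarrow> E \<subseteq> X \<Longrightarrow> E \<in> F"
  using assms unfolding upfamilies_def upfamily_def by blast+

text \<open>Upward closure lets the witnesses be as large as possible: \<open>Bs a\<close> becomes
  the set of all b with \<open>m a b \<in> E\<close>, and A the set of all a for which that set lies
  in G. Membership in a product is thus an iterated quantifier: for F-many a and G-many b.\<close>

lemma mem_ext_op: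
  assumes F: "F \<in> upfamilies X" and G: "G \<in> upfamilies X"
  shows "E \<in> ext_op X m F G \<longleftrightarrow> E \<subseteq> X \<and> {a \<in> X. {b \<in> X. m a b \<in> E} \<in> G} \<in> F"
proof
  assume "E \<in> ext_op X m F G"
  then obtain A Bs where E: "E \<subseteq> X" and A: "A \<in> F" and B: "\<And>a. a \<in> A \<Longrightarrow> Bs a \<in> G"
    and sub: "(\<Union>a\<in>A. m a ` Bs a) \<subseteq> E"
    unfolding ext_op_def by blast
  have "{b \<in> X. m a b \<in> E} \<in> G" if "a \<in> A" for a
    by (rule upfamiliesD(3)[OF G B[OF that]]) (use that sub upfamiliesD(1)[OF G B] in auto)
  then have "A \<subseteq> {a \<in> X. {b \<in> X. m a b \<in> E} \<in> G}" using upfamiliesD(1)[OF F A] by blast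
  then show "E \<subseteq> X \<and> {a \<in> X. {b \<in> X. m a b \<in> E} \<in> G} \<in> F"
    using upfamiliesD(3)[OF F A] E by blast
next
  assume *: "E \<subseteq> X \<and> {a \<in> X. {b \<in> X. m a b \<in> E} \<in> G} \<in> F"
  show "E \<in> ext_op X m F G"
    unfolding ext_op_def
    by (intro CollectI conjI bexI[of _ "{a \<in> X. {b \<in> X. m a b \<in> E} \<in> G}"]
        exI[of _ "\<lambda>a. {b \<in> X. m a b \<in> E}"]) (use * in auto)
qed

lemma ext_op_upfamilies:
  assumes F: "F \<in> upfamilies X" and G: "G \<in> upfamilies X"
  shows "ext_op X m F G \<in> upfamilies X"
  unfolding upfamilies_def upfamily_def
proof (intro CollectI conjI ballI allI impI)
  fix A assume A: "A \<in> ext_op X m F G"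
  then show "A \<subseteq> X" using mem_ext_op[OF F G] by blast
  show "A \<noteq> {}"
    using A upfamiliesD(2)[OF F] upfamiliesD(2)[OF G] unfolding mem_ext_op[OF F G] by force
  fix E assume E: "A \<subseteq> E \<and> E \<subseteq> X"
  have "{b \<in> X. m a b \<in> E} \<in> G" if "{b \<in> X. m a b \<in> A} \<in> G" for a
    by (rule upfamiliesD(3)[OF G that]) (use E in auto)
  then have "{a \<in> X. {b \<in> X. m a b \<in> A} \<in> G} \<subseteq> {a \<in> X. {b \<in> X. m a b \<in> E} \<in> G}"
    by auto
  then show "E \<in> ext_op X m F G"
    using A E upfamiliesD(3)[OF F] unfolding mem_ext_op[OF F G] by blast
qed

lemma ext_op_filters:
  assumes F: "F \<in> filters X" and G: "G \<in> filters X"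
  shows "ext_op X m F G \<in> filters X"
proof -
  have u: "F \<in> upfamilies X" "G \<in> upfamilies X" using F G filters_subset_upfamilies by blast+
  have iF: "A \<inter> B \<in> F" if "A \<in> F" "B \<in> F" for A B using that F unfolding filters_def by blast
  have iG: "A \<inter> B \<in> G" if "A \<in> G" "B \<in> G" for A B using that G unfolding filters_def by blast
  have "A \<inter> B \<in> ext_op X m F G" if A: "A \<in> ext_op X m F G" and B: "B \<in> ext_op X m F G" for A B
  proof -
    let ?S = "\<lambda>E. {a \<in> X. {b \<in> X. m a b \<in> E} \<in> G}"
    have "{b \<in> X. m a b \<in> A} \<inter> {b \<in> X. m a b \<in> B} = {b \<in> X. m a b \<in> A \<inter> B}" for a
      by auto
    then have "?S A \<inter> ?S B \<subseteq> ?S (A \<inter> B)" using iG by (force simp del: Int_iff)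
    then show ?thesis
      using A B iF[of "?S A" "?S B"] upfamiliesD(3)[OF u(1), of "?S A \<inter> ?S B" "?S (A \<inter> B)"]
      unfolding mem_ext_op[OF u] by blast
  qed
  then show ?thesis using ext_op_upfamilies[OF u] unfolding filters_def by blast
qed

section \<open>The semigroup of filters and its principal elements\<close>

locale sg =
  fixes X :: "'a set" and m :: "'a \<Rightarrow> 'a \<Rightarrow> 'a"
  assumes sg: "semigroup_on X m"
begin

lemmas cl = sgD(1)[OF sg] and as = sgD(2)[OF sg]

abbreviation "op \<equiv> ext_op X m"

text \<open>By \<open>mem_ext_op\<close> both sides say that for F-many a, G-many b and H-many c the
  product a b c lies in E; \<open>?Q a\<close> holds the inner part of this quantifier.\<close>

lemma ext_op_assoc:
  assumes F: "F \<in> upfamilies X" and G: "G \<in> upfamilies X" and H: "H \<in> upfamilies X"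
  shows "op (op F G) H = op F (op G H)"
proof (rule set_eqI)
  fix E
  let ?Q = "\<lambda>a. {b \<in> X. {c \<in> X. m a (m b c) \<in> E} \<in> H}"
  have 1: "{b \<in> X. m a b \<in> {u \<in> X. {c \<in> X. m u c \<in> E} \<in> H}} = ?Q a" if a: "a \<in> X" for a
  proof -
    have "{c \<in> X. m (m a b) c \<in> E} = {c \<in> X. m a (m b c) \<in> E}" if "b \<in> X" for b
      using a that as by auto
    then show ?thesis using a cl by auto
  qed
  have 2: "{b \<in> X. {c \<in> X. m b c \<in> {v \<in> X. m a v \<in> E}} \<in> H} = ?Q a" if a: "a \<in> X" for a
  proof -
    have "{c \<in> X. m b c \<in> {v \<in> X. m a v \<in> E}} = {c \<in> X. m a (m b c) \<in> E}" if "b \<in> X" for b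
      using a that cl by auto
    then show ?thesis by auto
  qed
  have "{a \<in> X. {b \<in> X. m a b \<in> {u \<in> X. {c \<in> X. m u c \<in> E} \<in> H}} \<in> G} = {a \<in> X. ?Q a \<in> G}"
    by (rule Collect_cong) (simp only: 1 cong: conj_cong)
  moreover have "{a \<in> X. {v \<in> X. m a v \<in> E} \<in> op G H} = {a \<in> X. ?Q a \<in> G}"
    unfolding mem_ext_op[OF G H] by (rule Collect_cong) (simp only: 2 Collect_restrict simp_thms cong: conj_cong)
  ultimately show "E \<in> op (op F G) H \<longleftrightarrow> E \<in> op F (op G H)"
    by (simp only: mem_ext_op[OF ext_op_upfamilies[OF F G] H]
        mem_ext_op[OF F ext_op_upfamilies[OF G H]] mem_ext_op[OF F G] Collect_restrict simp_thms)
qed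

lemma semigroup_filters: "semigroup_on (filters X) op"
  unfolding semigroup_on_def
  by (simp add: ext_op_filters ext_op_assoc filters_subset_upfamilies[THEN subsetD])

lemma mem_lift_mult:
  assumes P: "\<Phi> \<noteq> bot" "\<forall>\<^sub>F x in \<Phi>. x \<in> X" and Q: "\<Psi> \<noteq> bot" "\<forall>\<^sub>F x in \<Psi>. x \<in> X"
  shows "E \<in> op (lift X \<Phi>) (lift X \<Psi>) \<longleftrightarrow>
    E \<subseteq> X \<and> (\<forall>\<^sub>F a in \<Phi>. \<forall>\<^sub>F b in \<Psi>. m a b \<in> E)"
proof -
  have u: "lift X \<Phi> \<in> upfamilies X" "lift X \<Psi> \<in> upfamilies X"
    using lift_in_filters P Q filters_subset_upfamilies by blast+
  have *: "{b \<in> X. m a b \<in> E} \<in> lift X \<Psi> \<longleftrightarrow> (\<forall>\<^sub>F b in \<Psi>. m a b \<in> E)" for a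
    using Q(2) by (simp add: lift_def eventually_conj_iff)
  show ?thesis
    unfolding mem_ext_op[OF u] * using P(2) by (simp add: lift_def eventually_conj_iff)
qed

abbreviation "pr A \<equiv> lift X (principal A)"

lemma pr_filter: "A \<noteq> {} \<Longrightarrow> pr A \<in> filters X"
  by (rule lift_in_filters) (simp add: principal_eq_bot_iff)

lemma pr_inject: "A \<subseteq> X \<Longrightarrow> B \<subseteq> X \<Longrightarrow> pr A = pr B \<longleftrightarrow> A = B"
proof
  assume A: "A \<subseteq> X" "B \<subseteq> X" and eq: "pr A = pr B"
  have "E \<in> pr A \<longleftrightarrow> A \<subseteq> E" if "E \<subseteq> X" for A E
    using that by (auto simp: lift_def eventually_principal)
  from this[of A A] this[of A B] this[of B A] this[of B B] A eq show "A = B" by simp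
qed simp

lemma sprod_sub: "A \<subseteq> X \<Longrightarrow> B \<subseteq> X \<Longrightarrow> sprod m A B \<subseteq> X"
  unfolding sprod_def by (auto intro: cl)

lemma sprod_ne: "A \<noteq> {} \<Longrightarrow> B \<noteq> {} \<Longrightarrow> sprod m A B \<noteq> {}"
  unfolding sprod_def by blast

lemma pr_mult:
  assumes "A \<subseteq> X" "A \<noteq> {}" "B \<subseteq> X" "B \<noteq> {}"
  shows "op (pr A) (pr B) = pr (sprod m A B)"
proof (rule set_eqI)
  fix E
  show "E \<in> op (pr A) (pr B) \<longleftrightarrow> E \<in> pr (sprod m A B)"
    by (subst mem_lift_mult)
      (use assms in \<open>auto simp: principal_eq_bot_iff eventually_principal lift_def Ball_sprod\<close>)
qed

lemma sprod_sing: "sprod m {a} {b} = {m a b}"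
  unfolding sprod_def by blast

section \<open>From properties of filters to properties of elements and subsets of X\<close>

lemma idempotents_commute_elements:
  assumes ic: "idempotents_commute (filters X) op"
    and "e \<in> X" "f \<in> X" "m e e = e" "m f f = f"
  shows "m e f = m f e"
proof -
  have "op (pr {e}) (pr {f}) = op (pr {f}) (pr {e})"
    using ic pr_filter[of "{e}"] pr_filter[of "{f}"] assms
    unfolding idempotents_commute_def by (simp add: pr_mult sprod_sing)
  then show ?thesis using assms cl by (simp add: pr_mult sprod_sing pr_inject)
qed

text \<open>The trace of the sub-Clifford property on principal filters. Together with
  \<open>regular_sets\<close> it lets both alternatives of (3) be tested on the same sets A.\<close>

definition cancel_sets :: bool where
  "cancel_sets \<longleftrightarrow> (\<forall>A. A \<subseteq> X \<longrightarrow> A \<noteq> {} \<longrightarrow>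
     sprod m A (sprod m A A) = sprod m A A \<longrightarrow> sprod m A A = A)"

text \<open>The trace of regularity in the linked upfamilies. One y is shared by two elements of A
  rather than by all of A, because linkedness makes members meet only in pairs.\<close>

definition regular_sets :: bool where
  "regular_sets \<longleftrightarrow> (\<forall>A. A \<subseteq> X \<longrightarrow> A \<noteq> {} \<longrightarrow> (\<forall>a\<in>A. \<forall>a'\<in>A. \<exists>y\<in>X. \<forall>b\<in>A.
     m (m a y) b \<in> A \<and> m (m a' y) b \<in> A))"

lemma cancel_setsD:
  assumes "cancel_sets" "A \<subseteq> X" "A \<noteq> {}" "sprod m A A = B" "sprod m A B = B"
  shows "A = B"
  using assms(1)[unfolded cancel_sets_def, rule_format, OF assms(2,3)] assms(4,5) by simp

lemma regular_setsE:
  assumes "regular_sets" "A \<subseteq> X" "a \<in> A" "a' \<in> A"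
  obtains y where "y \<in> X" "\<And>b. b \<in> A \<Longrightarrow> m (m a y) b \<in> A" "\<And>b. b \<in> A \<Longrightarrow> m (m a' y) b \<in> A"
proof -
  have "A \<noteq> {}" using assms(3) by blast
  from assms(1)[unfolded regular_sets_def, rule_format, OF assms(2) this assms(3,4)] that
  show thesis by blast
qed

text \<open>F and F F lie in one cancellative subsemigroup, where F can be cancelled on the
  left.\<close>

lemma sub_clifford_cube:
  assumes sc: "sub_clifford_on (filters X) op" and F: "F \<in> filters X"
    and eq: "op F (op F F) = op F F"
  shows "op F F = F"
proof -
  obtain T where "F \<in> T" and T: "cancellative_subsemigroup T op"
    using sc F unfolding sub_clifford_on_def by blast
  moreover from this have "op F F \<in> T" unfolding cancellative_subsemigroup_def by blast
  ultimately show ?thesis using eq unfolding cancellative_subsemigroup_def by blast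
qed

lemma cancel_sets_if_sub_clifford:
  assumes sc: "sub_clifford_on (filters X) op"
  shows cancel_sets
  unfolding cancel_sets_def
proof (intro allI impI)
  fix A assume A: "A \<subseteq> X" "A \<noteq> {}" and eq: "sprod m A (sprod m A A) = sprod m A A"
  have "op (pr A) (pr A) = pr A"
    by (rule sub_clifford_cube[OF sc pr_filter[OF A(2)]])
      (use A eq in \<open>simp add: pr_mult sprod_sub sprod_ne\<close>)
  then show "sprod m A A = A" using A by (simp add: pr_mult pr_inject sprod_sub)
qed

lemma pr_upfamily: "A \<noteq> {} \<Longrightarrow> pr A \<in> upfamilies X"
  using pr_filter filters_subset_upfamilies by blast

text \<open>Since A belongs to the product of \<open>pr A\<close>, Y and \<open>pr A\<close>, for
  each c in A the y with c y A \<subseteq> A form a member of Y. The members obtained from a and a'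
  meet.\<close>

lemma regular_sets_if_regular_in:
  assumes reg: "regular_in (filters X) (linked_upfamilies X) op"
  shows regular_sets
  unfolding regular_sets_def
proof (intro allI impI ballI)
  fix A a a' assume A: "A \<subseteq> X" "A \<noteq> {}" and a: "a \<in> A" and a': "a' \<in> A"
  obtain Y where Y: "Y \<in> linked_upfamilies X" and eq: "op (op (pr A) Y) (pr A) = pr A"
    using reg pr_filter[OF A(2)] unfolding regular_in_def by blast
  have uY: "Y \<in> upfamilies X" using Y linked_subset_upfamilies by blast
  have uA: "pr A \<in> upfamilies X" using pr_upfamily A by blast
  have "A \<in> op (op (pr A) Y) (pr A)" unfolding eq using A by (simp add: lift_def eventually_principal)
  then have *: "{y \<in> X. m c y \<in> {u \<in> X. {b \<in> X. m u b \<in> A} \<in> pr A}} \<in> Y" if "c \<in> A" for c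
    using that unfolding mem_ext_op[OF ext_op_upfamilies[OF uA uY] uA] mem_ext_op[OF uA uY]
    by (subst (asm) (3) lift_def) (simp add: eventually_principal)
  obtain y where "y \<in> {y \<in> X. m a y \<in> {u \<in> X. {b \<in> X. m u b \<in> A} \<in> pr A}}"
    "y \<in> {y \<in> X. m a' y \<in> {u \<in> X. {b \<in> X. m u b \<in> A} \<in> pr A}}"
    using Y *[OF a] *[OF a'] unfolding linked_upfamilies_def by blast
  then show "\<exists>y\<in>X. \<forall>b\<in>A. m (m a y) b \<in> A \<and> m (m a' y) b \<in> A"
    by (auto simp: lift_def eventually_principal)
qed

lemma regular_element_if_regular_sets:
  assumes "regular_sets" "x \<in> X"
  shows "\<exists>y\<in>X. m (m x y) x = x"
proof -
  obtain y where "y \<in> X" "m (m x y) x \<in> {x}"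
    by (rule regular_setsE[OF assms(1), of "{x}" x x]) (use assms in auto)
  then show ?thesis by blast
qed

section \<open>Subgroups, pairs of idempotents and nonidempotents under the set conditions\<close>

text \<open>The test set is A = G - {e}. With two distinct elements in A one gets A A = A G = G,
  against cancellation. Under regularity the shared y yields one element e y e that is inverse to
  both g and h.\<close>

lemma subgroup_nonidentity_unique:
  assumes K: "cancel_sets \<or> regular_sets"
    and G: "G \<subseteq> X" "is_subgroup_on G m"
    and e: "e \<in> G" "m e e = e"
    and g: "g \<in> G" "g \<noteq> e" and h: "h \<in> G" "h \<noteq> e"
  shows "g = h"
proof (rule ccontr)
  assume "g \<noteq> h"
  have clG: "m a b \<in> G" if "a \<in> G" "b \<in> G" for a b
    using G(2) that unfolding is_subgroup_on_def by blast
  obtain e' where e': "e' \<in> G" "\<forall>g\<in>G. m e' g = g \<and> m g e' = g"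
    and iv: "\<forall>g\<in>G. \<exists>h\<in>G. m g h = e' \<and> m h g = e'"
    using G(2) unfolding is_subgroup_on_def by blast
  have X: "a \<in> X" if "a \<in> G" for a using that G by blast
  have "e' = e"
  proof -
    obtain k where "k \<in> G" "m e k = e'" using iv e by blast
    then show ?thesis using e e' as[of e e k] X by auto
  qed
  then have idl: "m e a = a" and idr: "m a e = a" if "a \<in> G" for a using e' that by auto
  obtain i where i: "\<And>a. a \<in> G \<Longrightarrow> i a \<in> G" "\<And>a. a \<in> G \<Longrightarrow> m a (i a) = e"
    "\<And>a. a \<in> G \<Longrightarrow> m (i a) a = e"
    using iv \<open>e' = e\<close> by metis
  have il: "m a (m (i a) b) = b" and ir: "m (i a) (m a b) = b" if "a \<in> G" "b \<in> G" for a b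
    using that i idl as[of a "i a" b] as[of "i a" a b] X by auto
  define A where "A = G - {e}"
  have A: "A \<subseteq> X" "A \<noteq> {}" "A \<subseteq> G" "g \<in> A" "h \<in> A" using G g h unfolding A_def by auto
  show False
    using K
  proof
    assume cancel_sets
    have AA: "sprod m A A = G"
    proof
      show "sprod m A A \<subseteq> G" using clG unfolding sprod_def A_def by auto
      show "G \<subseteq> sprod m A A"
      proof
        fix u assume u: "u \<in> G"
        \<comment> \<open>As A has two elements, one differs from u; then u = a (i a u), where i a u
          is not e and so lies in A.\<close>
        obtain a where a: "a \<in> A" "a \<noteq> u" using A \<open>g \<noteq> h\<close> by metis
        have aG: "a \<in> G" using a A by blast
        have "m (i a) u \<noteq> e" using il[OF aG u] idr[OF aG] a by auto
        then have "m (i a) u \<in> A" using i clG aG u unfolding A_def by auto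
        then show "u \<in> sprod m A A" using il[OF aG u] a unfolding sprod_def by force
      qed
    qed
    have "sprod m A G = G"
    proof
      show "sprod m A G \<subseteq> G" using clG unfolding sprod_def A_def by auto
      show "G \<subseteq> sprod m A G"
      proof
        fix u assume u: "u \<in> G"
        have "m (i g) u \<in> G" using i clG g u by auto
        then show "u \<in> sprod m A G" using il[OF g(1) u] A unfolding sprod_def by force
      qed
    qed
    from cancel_setsD[OF \<open>cancel_sets\<close> A(1,2) AA this] show False using e unfolding A_def by blast
  next
    assume regular_sets
    then obtain y where y: "y \<in> X" "\<And>b. b \<in> A \<Longrightarrow> m (m g y) b \<in> A"
      "\<And>b. b \<in> A \<Longrightarrow> m (m h y) b \<in> A"
      using regular_setsE[OF _ A(1,4,5)] by metis
    \<comment> \<open>The element y may lie outside G, but z = c y e = (c y b) (i b) lies in G. Left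
      translation by z maps A into A; if z were not e, then i z would be in A and be sent to e. So z
      = e, and e y e is the inverse of c.\<close>
    have "m e (m y e) \<in> G \<and> m c (m e (m y e)) = e"
      if c: "c \<in> G" and cy: "\<And>b. b \<in> A \<Longrightarrow> m (m c y) b \<in> A" for c
    proof -
      have cyG: "m c (m y b) \<in> G" "m c (m y b) \<noteq> e" if "b \<in> A" for b
        using cy[OF that] that as[of c y b] c y X A unfolding A_def by auto
      have eq: "m c (m y e) = m (m c (m y b)) (i b)" if "b \<in> A" for b
        using that i[of b] c y A as cl X[of b] X[of "i b"] X[OF c] by auto
      have zG: "m c (m y e) \<in> G" unfolding eq[OF A(4)] using cyG[OF A(4)] i clG g by auto
      have z: "m c (m e (m y e)) = m c (m y e)"
        using as[of c e "m y e"] c idr X e y cl by auto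
      have "m c (m y e) = e"
      proof (rule ccontr)
        assume ne: "m c (m y e) \<noteq> e"
        define b where "b = i (m c (m y e))"
        have bG: "b \<in> G" and zb: "m (m c (m y e)) b = e" using i zG unfolding b_def by auto
        have "b \<noteq> e" using zb ne idr[OF zG] by auto
        then have "b \<in> A" using bG unfolding A_def by auto
        moreover have "m c (m y b) = e" using zb as cl X[OF c] y X[OF e(1)] X[OF bG] idl[OF bG] by simp
        ultimately show False using cyG by blast
      qed
      moreover have "m e (m y e) = m (i c) (m c (m y e))"
        using as[of "i c" c "m y e"] X i c y cl e by simp
      ultimately show ?thesis using z i(1)[OF c] idr[OF i(1)[OF c]] by simp
    qed
    from this[OF g(1) y(2)] this[OF h(1) y(3)] have w: "m e (m y e) \<in> G"
      and "m g (m e (m y e)) = e" "m h (m e (m y e)) = e" by auto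
    then have "m (m g (m e (m y e))) (i (m e (m y e))) = m (m h (m e (m y e))) (i (m e (m y e)))"
      by simp
    then have "g = h" using as[OF X X X, OF _ w i(1)[OF w]] g h i(2)[OF w] idr by simp
    then show False using \<open>g \<noteq> h\<close> by blast
  qed
qed

lemma sprod_insert: "sprod m {a, b} C = m a ` C \<union> m b ` C"
  unfolding sprod_def by auto

text \<open>For A = {e, f}, both A A and A A A equal {e, f, e f}. Under regularity w = e y f lies in
  A and satisfies e w = w = w f: the case w = e gives e f = e, and w = f gives e f = f.\<close>

lemma idempotents_chain:
  assumes K: "cancel_sets \<or> regular_sets"
    and e: "e \<in> X" "m e e = e" and f: "f \<in> X" "m f f = f" and ef: "m e f = m f e"
  shows "m e f = e \<or> m e f = f"
proof (rule ccontr)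
  assume n: "\<not> ?thesis"
  have s: "m e (m e z) = m e z" "m f (m f z) = m f z" "m e (m f z) = m f (m e z)" if "z \<in> X" for z
    using as[of e e z] as[of f f z] as[of e f z] as[of f e z] e f ef that by simp_all
  have A: "{e, f} \<subseteq> X" "{e, f} \<noteq> {}" using e f by auto
  show False
    using K
  proof
    assume cancel_sets
    have "sprod m {e, f} {e, f} = {e, f, m e f}" using e f ef by (auto simp: sprod_insert)
    moreover have "sprod m {e, f} {e, f, m e f} = {e, f, m e f}"
      using e f ef s[OF e(1)] s[OF f(1)] by (auto simp: sprod_insert)
    ultimately have "{e, f} = {e, f, m e f}" using cancel_setsD[OF \<open>cancel_sets\<close> A] by blast
    then show False using n by blast
  next
    assume regular_sets
    then obtain y where y: "y \<in> X" "\<And>b. b \<in> {e, f} \<Longrightarrow> m (m e y) b \<in> {e, f}"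
      "\<And>b. b \<in> {e, f} \<Longrightarrow> m (m f y) b \<in> {e, f}"
      using regular_setsE[OF _ A(1), of e f] by blast
    have "m e (m (m e y) f) = m (m e y) f" "m (m (m e y) f) f = m (m e y) f"
      using y e f s by (simp_all add: as cl)
    moreover have "m (m e y) f = e \<or> m (m e y) f = f" using y(2)[of f] by blast
    ultimately show False using n by auto
  qed
qed

text \<open>Here x generates a group of order 2 with identity \<open>m x x\<close>, and f is an
  idempotent above that identity. For A = {x, f} strictly above would give A A = A A A = {x, f, x
  x}, larger than A. Under regularity it would make x idempotent.\<close>

lemma nonidempotent_top:
  assumes K: "cancel_sets \<or> regular_sets"
    and x: "x \<in> X" "m x x \<noteq> x" "m (m x x) x = x"
    and f: "f \<in> X" "m f f = f" and xf: "m (m x x) f = m x x" "m f (m x x) = m x x"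
  shows "m x x = f"
proof (rule ccontr)
  assume n: "m x x \<noteq> f"
  have xx: "m x (m x x) = x" using x as by simp
  have xfx: "m x f = x"
  proof -
    have "m x f = m (m x (m x x)) f" using xx by simp
    also have "\<dots> = m x (m (m x x) f)" using as[OF x(1) cl[OF x(1) x(1)] f(1)] by simp
    also have "\<dots> = x" using xf xx by simp
    finally show ?thesis .
  qed
  have fxx: "m f x = x"
  proof -
    have "m f x = m f (m (m x x) x)" using x by simp
    also have "\<dots> = m (m f (m x x)) x" using as[OF f(1) cl[OF x(1) x(1)] x(1)] by simp
    also have "\<dots> = x" using xf x by simp
    finally show ?thesis .
  qed
  have nf: "x \<noteq> f" using n xfx by auto
  have A: "{x, f} \<subseteq> X" "{x, f} \<noteq> {}" using x f by auto
  show False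
    using K
  proof
    assume cancel_sets
    have "sprod m {x, f} {x, f} = {x, f, m x x}" using f xfx fxx by (auto simp: sprod_insert)
    moreover have "sprod m {x, f} {x, f, m x x} = {x, f, m x x}"
      using f xfx fxx xf xx by (auto simp: sprod_insert)
    ultimately have "{x, f} = {x, f, m x x}" using cancel_setsD[OF \<open>cancel_sets\<close> A] by blast
    then show False using n x by auto
  next
    assume regular_sets
    then obtain y where y: "y \<in> X" "\<And>b. b \<in> {x, f} \<Longrightarrow> m (m x y) b \<in> {x, f}"
      "\<And>b. b \<in> {x, f} \<Longrightarrow> m (m f y) b \<in> {x, f}"
      using regular_setsE[OF _ A(1), of x f] by blast
    \<comment> \<open>If f were a multiple (x x) z, then (x x) f = f, although (x x) f = x x. Every
      x z is such a multiple because x = (x x) x; hence x y f and x y x, being in A, both equal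
      x.\<close>
    have nn: "f \<noteq> m (m x x) z" if "z \<in> X" for z
    proof
      assume z: "f = m (m x x) z"
      have "m (m x x) (m x x) = m x x" using as[of "m x x" x x] x cl by simp
      then have "m (m x x) f = f" using as[of "m x x" "m x x" z] z that x cl by simp
      then show False using xf n by simp
    qed
    have nx: "m x z \<noteq> f" if "z \<in> X" for z
      using nn[of "m x z"] x(1) x(3) that as[of x x "m x z"] as[of x x z] as[of x "m x x" z] xx cl by metis
    have 1: "m (m x y) f = x" and 2: "m (m x y) x = x"
      using y(2)[of f] y(2)[of x] nx[of "m y f"] nx[of "m y x"] x y f by (auto simp: as cl)
    have 3: "m (m f y) f \<in> {x, f}" using y(3) by blast
    have c: "m x (m (m f y) f) = m (m x y) f"
      using as[of x f "m y f"] xfx x y f by (simp add: as cl)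
    \<comment> \<open>The other value x is impossible: x (f y f) = x y f = x, while x x is not x.
      Replacing f y f by f in x (f y f) x = x y x = x gives x x = x.\<close>
    have "m (m f y) f = f" using 3 1 c x by auto
    moreover have "m x (m (m (m f y) f) x) = m (m x y) x"
      using as[of x f "m y (m f x)"] xfx fxx x y f by (simp add: as cl)
    ultimately have "m x x = x" using 2 fxx by simp
    then show False using x by blast
  qed
qed

section \<open>Powers and regular elements in the sub-Clifford case\<close>

text \<open>\<open>pw x n\<close> is the power of x with exponent n + 1, as there is no unit to
  start from; hence the \<open>Suc\<close> in \<open>pw_mult\<close>.\<close>

primrec pw :: "'a \<Rightarrow> nat \<Rightarrow> 'a" where
  "pw x 0 = x"
| "pw x (Suc n) = m x (pw x n)"

lemma pw_in: "x \<in> X \<Longrightarrow> pw x n \<in> X"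
  by (induction n) (auto intro: cl)

lemma pw_mult: "x \<in> X \<Longrightarrow> m (pw x i) (pw x j) = pw x (Suc (i + j))"
  by (induction i) (simp_all add: as pw_in)

text \<open>The filter \<open>F\<close> of sets that contain almost all powers of \<open>x\<close> with index not divisible by 3
  satisfies \<open>F F = F F F\<close>, the filter of sets containing almost all powers of \<open>x\<close>:
  two translates of the non-multiples of 3 already cover all large numbers.\<close>

lemma sub_clifford_periodic:
  assumes sc: "sub_clifford_on (filters X) op" and x: "x \<in> X"
  shows "\<exists>i j. i < j \<and> pw x i = pw x j"
proof -
  define D :: "nat set" where "D = {n. \<not> 3 dvd n}"
  define \<Phi> where "\<Phi> = filtermap (pw x) (inf sequentially (principal D))"
  define \<Psi> where "\<Psi> = filtermap (pw x) sequentially"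
  have \<Phi>: "eventually P \<Phi> \<longleftrightarrow> (\<exists>N. \<forall>n\<ge>N. n \<in> D \<longrightarrow> P (pw x n))" for P
    unfolding \<Phi>_def by (simp add: eventually_filtermap eventually_inf_principal eventually_sequentially)
  have \<Psi>: "eventually P \<Psi> \<longleftrightarrow> (\<exists>N. \<forall>n\<ge>N. P (pw x n))" for P
    unfolding \<Psi>_def by (simp add: eventually_filtermap eventually_sequentially)
  have D: "3 * N + 1 \<in> D" "3 * N + 2 \<in> D" for N :: nat
    unfolding D_def mem_Collect_eq by presburger+
  have n: "\<Phi> \<noteq> bot" "\<Psi> \<noteq> bot"
  proof -
    have "\<exists>n\<ge>N. n \<in> D" for N using D(1)[of N] by (intro exI[of _ "3 * N + 1"]) auto
    then show "\<Phi> \<noteq> bot" by (simp add: trivial_limit_def \<Phi>)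
    show "\<Psi> \<noteq> bot" by (simp add: trivial_limit_def \<Psi>) blast
  qed
  have X: "eventually (\<lambda>x. x \<in> X) \<Phi>" "eventually (\<lambda>x. x \<in> X) \<Psi>"
    by (simp_all add: \<Phi> \<Psi> pw_in x)
  have shift: "(\<exists>N. \<forall>j\<ge>N. P (Suc (i + j))) \<longleftrightarrow> (\<exists>N. \<forall>j\<ge>N. P j)" for P and i :: nat
  proof
    assume "\<exists>N. \<forall>j\<ge>N. P (Suc (i + j))"
    then obtain N where N: "\<And>j. j \<ge> N \<Longrightarrow> P (Suc (i + j))" by blast
    have "P n" if "n \<ge> Suc (i + N)" for n using N[of "n - Suc i"] that by simp
    then show "\<exists>N. \<forall>j\<ge>N. P j" by blast
  next
    assume "\<exists>N. \<forall>j\<ge>N. P j"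
    then obtain N where N: "\<And>j. j \<ge> N \<Longrightarrow> P j" by blast
    show "\<exists>N. \<forall>j\<ge>N. P (Suc (i + j))" by (rule exI[of _ N]) (simp add: N)
  qed
  have 1: "op (lift X \<Phi>) (lift X \<Phi>) = lift X \<Psi>"
  proof (rule set_eqI)
    fix E
    have "(\<exists>N. \<forall>i\<ge>N. i \<in> D \<longrightarrow> (\<exists>M. \<forall>j\<ge>M. j \<in> D \<longrightarrow> pw x (Suc (i + j)) \<in> E)) \<longleftrightarrow>
        (\<exists>N. \<forall>n\<ge>N. pw x n \<in> E)"
    proof
      assume "\<exists>N. \<forall>i\<ge>N. i \<in> D \<longrightarrow> (\<exists>M. \<forall>j\<ge>M. j \<in> D \<longrightarrow> pw x (Suc (i + j)) \<in> E)"
      then obtain N where N: "\<And>i. i \<ge> N \<Longrightarrow> i \<in> D \<Longrightarrow> \<exists>M. \<forall>j\<ge>M. j \<in> D \<longrightarrow> pw x (Suc (i + j)) \<in> E"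
        by blast
      obtain M1 M2 where M1: "\<forall>j\<ge>M1. j \<in> D \<longrightarrow> pw x (Suc (3 * N + 1 + j)) \<in> E"
        and M2: "\<forall>j\<ge>M2. j \<in> D \<longrightarrow> pw x (Suc (3 * N + 2 + j)) \<in> E"
        using N[OF _ D(1), of N] N[OF _ D(2), of N] by auto
      \<comment> \<open>Write n = i + j + 1 with i = 3 N + 1 or i = 3 N + 2. The two candidates for
        j are consecutive, so at least one is not a multiple of 3.\<close>
      have "pw x n \<in> E" if n: "n \<ge> 3 * N + 3 + M1 + M2" for n
      proof (cases "n - 3 * N - 2 \<in> D")
        case True
        moreover have "n - 3 * N - 2 \<ge> M1" "Suc (3 * N + 1 + (n - 3 * N - 2)) = n" using n by simp_all
          ultimately show ?thesis using M1 by metis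
      next
        case False
        then have "n - 3 * N - 3 \<in> D" using n unfolding D_def mem_Collect_eq by presburger
        moreover have "n - 3 * N - 3 \<ge> M2" "Suc (3 * N + 2 + (n - 3 * N - 3)) = n" using n by simp_all
          ultimately show ?thesis using M2 by metis
      qed
      then show "\<exists>N. \<forall>n\<ge>N. pw x n \<in> E" by blast
    next
      assume "\<exists>N. \<forall>n\<ge>N. pw x n \<in> E"
      then obtain N where "\<And>n. n \<ge> N \<Longrightarrow> pw x n \<in> E" by blast
      then show "\<exists>N. \<forall>i\<ge>N. i \<in> D \<longrightarrow> (\<exists>M. \<forall>j\<ge>M. j \<in> D \<longrightarrow> pw x (Suc (i + j)) \<in> E)"
        by (intro exI[of _ N]) (auto simp del: pw.simps)
    qed
    then show "E \<in> op (lift X \<Phi>) (lift X \<Phi>) \<longleftrightarrow> E \<in> lift X \<Psi>"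
      unfolding mem_lift_mult[OF n(1) X(1) n(1) X(1)] by (simp add: lift_def \<Phi> \<Psi> pw_mult x)
  qed
  have 2: "op (lift X \<Phi>) (lift X \<Psi>) = lift X \<Psi>"
  proof (rule set_eqI)
    fix E
    have "(\<exists>N. \<forall>i\<ge>N. i \<in> D \<longrightarrow> Q) \<longleftrightarrow> Q" for Q
    proof
      assume "\<exists>N. \<forall>i\<ge>N. i \<in> D \<longrightarrow> Q"
      then obtain N where "\<forall>i\<ge>N. i \<in> D \<longrightarrow> Q" by blast
      then show Q using D(1)[of N] by (elim allE[of _ "3 * N + 1"]) simp
    qed blast
    then show "E \<in> op (lift X \<Phi>) (lift X \<Psi>) \<longleftrightarrow> E \<in> lift X \<Psi>"
      unfolding mem_lift_mult[OF n(1) X(1) n(2) X(2)]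
      by (simp add: lift_def \<Phi> \<Psi> pw_mult x shift[of "\<lambda>n. pw x n \<in> E"] del: pw.simps)
  qed
  have "lift X \<Psi> = lift X \<Phi>"
    using sub_clifford_cube[OF sc lift_in_filters[OF n(1)]] unfolding 1 2 by blast
  \<comment> \<open>Since the two filters agree, almost all powers occur among those with index in
    D. A power with index 3 N then repeats one with an index not divisible by 3.\<close>
  moreover have "pw x ` D \<in> lift X \<Phi>" using x by (auto simp: lift_def \<Phi> pw_in)
  ultimately have "pw x ` D \<in> lift X \<Psi>" by simp
  then obtain N where "\<forall>n\<ge>N. pw x n \<in> pw x ` D" unfolding lift_def \<Psi> by blast
  then have "pw x (3 * N) \<in> pw x ` D" by simp
  then obtain k where "k \<in> D" "pw x (3 * N) = pw x k" by blast
  moreover have "k \<noteq> 3 * N" using \<open>k \<in> D\<close> unfolding D_def by auto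
  ultimately show ?thesis by (metis nat_neq_iff)
qed

text \<open>All powers of x have their principal filters in one cancellative T, so a repetition
  among the powers can be cancelled down to x = \<open>pw x (Suc k)\<close>. Splitting off a factor
  x at both ends leaves y; for k = 0 x is idempotent and y = x works.\<close>

lemma regular_element_if_sub_clifford:
  assumes sc: "sub_clifford_on (filters X) op" and x: "x \<in> X"
  shows "\<exists>y\<in>X. m (m x y) x = x"
proof -
  obtain i j where ij: "i < j" "pw x i = pw x j" using sub_clifford_periodic[OF sc x] by blast
  obtain T where T: "pr {x} \<in> T" "cancellative_subsemigroup T op"
    using sc pr_filter[of "{x}"] unfolding sub_clifford_on_def by blast
  have pwT: "pr {pw x n} \<in> T" for n
  proof (induction n)
    case (Suc n)
    have "op (pr {x}) (pr {pw x n}) \<in> T"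
      using T Suc unfolding cancellative_subsemigroup_def by blast
    then show ?case using x pw_in[OF x] by (simp add: pr_mult sprod_sing)
  qed (use T in simp)
  obtain k where k: "pw x (Suc k) = x"
  proof (cases i)
    case 0
    then show ?thesis using that[of "j - 1"] ij by simp
  next
    case (Suc i')
    have e: "op (pr {pw x i'}) (pr {pw x 0}) = op (pr {pw x i'}) (pr {pw x (j - i)})"
      using ij Suc pw_in[OF x] by (simp add: pr_mult sprod_sing pw_mult[OF x] del: pw.simps)
    have "pr {pw x 0} = pr {pw x (j - i)}"
      using T(2)[unfolded cancellative_subsemigroup_def, THEN conjunct2, rule_format, THEN conjunct1,
          rule_format, OF pwT pwT pwT e] .
    then have "pw x (j - i) = x" using x pw_in[OF x] by (simp add: pr_inject)
    then show ?thesis using that[of "j - i - 1"] ij by (simp add: Suc_diff_Suc)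
  qed
  show ?thesis
  proof (cases k)
    case 0
    then show ?thesis using k x by (intro bexI[of _ x]) auto
  next
    case (Suc l)
    have "m (m x (pw x l)) x = x" using k Suc x pw_mult[OF x, of "Suc l" 0] by simp
    then show ?thesis using pw_in[OF x] by blast
  qed
qed

lemma regular_element_inverse:
  assumes x: "x \<in> X" and y: "\<exists>y\<in>X. m (m x y) x = x"
  shows "\<exists>y\<in>X. m (m x y) x = x \<and> m (m y x) y = y"
proof -
  obtain y where y: "y \<in> X" "m (m x y) x = x" using y by blast
  have 1: "m x (m y x) = x" using y x by (simp add: as)
  have 2: "m x (m y (m x z)) = m x z" if "z \<in> X" for z
    using as[of x "m y x" z] as[of y x z] 1 that x y cl by simp
  show ?thesis
    \<comment> \<open>The usual passage from a y with x y x = x to the inverse y x y.\<close>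
    by (rule bexI[of _ "m (m y x) y"]) (use x y 1 2 in \<open>simp_all add: as cl\<close>)
qed

section \<open>Finiteness of the set of idempotents\<close>

definition idem :: "'a set" where "idem = {e \<in> X. m e e = e}"

abbreviation seqf :: "(nat \<Rightarrow> 'a) \<Rightarrow> 'a set set" where
  "seqf p \<equiv> lift X (filtermap p sequentially)"

lemma seqf_filter: "seqf p \<in> filters X"
  by (rule lift_in_filters) (simp add: filtermap_bot_iff)

text \<open>By \<open>abs\<close> the inner eventual quantifier over q reduces to
  \<open>p i \<in> E\<close>, leaving only the outer one. In \<open>seqf_mult_right\<close> the
  outer one drops out instead.\<close>

lemma seqf_mult_left:
  assumes "range p \<subseteq> X" "range q \<subseteq> X"
    and abs: "\<And>i. \<forall>\<^sub>F j in sequentially. m (p i) (q j) = p i"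
  shows "op (seqf p) (seqf q) = seqf p"
proof (rule set_eqI)
  fix E
  have "(\<forall>\<^sub>F j in sequentially. m (p i) (q j) \<in> E) \<longleftrightarrow> p i \<in> E" for i
  proof -
    have "(\<forall>\<^sub>F j in sequentially. m (p i) (q j) \<in> E) \<longleftrightarrow> (\<forall>\<^sub>F j in sequentially. p i \<in> E)"
      by (rule eventually_cong[OF abs[of i]]) simp
    then show ?thesis by simp
  qed
  then show "E \<in> op (seqf p) (seqf q) \<longleftrightarrow> E \<in> seqf p"
    by (subst mem_lift_mult)
      (use assms(1,2)[THEN range_subsetD] in
        \<open>auto simp: filtermap_bot_iff eventually_filtermap lift_def\<close>)
qed

lemma seqf_mult_right:
  assumes "range p \<subseteq> X" "range q \<subseteq> X"
    and abs: "\<And>i. \<forall>\<^sub>F j in sequentially. m (p i) (q j) = q j"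
  shows "op (seqf p) (seqf q) = seqf q"
proof (rule set_eqI)
  fix E
  have "(\<forall>\<^sub>F j in sequentially. m (p i) (q j) \<in> E) \<longleftrightarrow> (\<forall>\<^sub>F j in sequentially. q j \<in> E)" for i
    by (rule eventually_cong[OF abs[of i]]) simp
  then show "E \<in> op (seqf p) (seqf q) \<longleftrightarrow> E \<in> seqf q"
    by (subst mem_lift_mult)
      (use assms(1,2)[THEN range_subsetD] in
        \<open>auto simp: filtermap_bot_iff eventually_filtermap lift_def\<close>)
qed

lemma finite_idem:
  assumes ic: "idempotents_commute (filters X) op"
    and chain: "\<And>e f. e \<in> idem \<Longrightarrow> f \<in> idem \<Longrightarrow> m e f = e \<or> m e f = f"
  shows "finite idem"
proof (rule ccontr)
  assume "infinite idem"
  then obtain s :: "nat \<Rightarrow> 'a" where s: "inj s" "range s \<subseteq> idem"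
    using infinite_countable_subset by blast
  \<comment> \<open>Ramsey's theorem colours unordered pairs, so \<open>Min\<close> and
    \<open>Max\<close> recover the order of the indices; colour 0 means that the earlier idempotent
    lies below the later one.\<close>
  define c where "c S = (if m (s (Min S)) (s (Max S)) = s (Min S) then 0 else 1 :: nat)" for S
  obtain Y t where Y: "infinite Y"
    and mono: "\<And>i j. i \<in> Y \<Longrightarrow> j \<in> Y \<Longrightarrow> i \<noteq> j \<Longrightarrow> c {i, j} = t"
  proof -
    have "\<exists>Y t. Y \<subseteq> UNIV \<and> infinite Y \<and> t < 2 \<and> (\<forall>x\<in>Y. \<forall>y\<in>Y. x \<noteq> y \<longrightarrow> c {x, y} = t)"
      by (rule Ramsey2[OF infinite_UNIV_nat]) (simp add: c_def)
    then obtain Y t where "infinite Y" "\<forall>x\<in>Y. \<forall>y\<in>Y. x \<noteq> y \<longrightarrow> c {x, y} = t" by blast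
    then show thesis using that by simp
  qed
  define r where "r n = s (enumerate Y n)" for n
  have r: "inj r"
  proof (rule injI)
    fix i j assume "r i = r j"
    then have "enumerate Y i = enumerate Y j" unfolding r_def using s(1) by (rule injD[rotated])
    then show "i = j" using strict_mono_eq[OF strict_mono_enumerate[OF Y]] by blast
  qed
  have rX: "r n \<in> X" and rr: "m (r n) (r n) = r n" for n
    using s unfolding r_def idem_def by auto
  have rc: "m (r i) (r j) = m (r j) (r i)" for i j
    using idempotents_commute_elements[OF ic rX rX rr rr] .
  have c: "c {enumerate Y i, enumerate Y j} = t" if "i < j" for i j
    using mono[of "enumerate Y i" "enumerate Y j"] enumerate_in_set[OF Y] enumerate_mono[OF that Y] by auto
  have ms: "m (r i) (r j) = r i \<longleftrightarrow> c {enumerate Y i, enumerate Y j} = 0" if "i < j" for i j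
    unfolding c_def r_def using enumerate_mono[OF that Y] by (simp add: min_def max_def)
  \<comment> \<open>Colour 0 makes r increasing; otherwise \<open>chain\<close> makes it
    decreasing.\<close>
  have dich: "(\<forall>i j. i < j \<longrightarrow> m (r i) (r j) = r i) \<or> (\<forall>i j. i < j \<longrightarrow> m (r i) (r j) = r j)"
  proof (cases "t = 0")
    case True
    then show ?thesis using ms c by auto
  next
    case False
    then have "m (r i) (r j) \<noteq> r i" if "i < j" for i j using ms[OF that] c[OF that] by auto
    moreover have "m (r i) (r j) = r i \<or> m (r i) (r j) = r j" for i j
      using chain[of "r i" "r j"] rX rr unfolding idem_def by auto
    ultimately show ?thesis by blast
  qed
  define p where "p n = r (2 * n)" for n
  define q where "q n = r (2 * n + 1)" for n
  have X: "range p \<subseteq> X" "range q \<subseteq> X" using rX unfolding p_def q_def by auto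
  \<comment> \<open>If r increases, each product of the two filters is its left factor; if r
    decreases, its right factor. Both filters are idempotent, so they commute and coincide, although
    p and q have disjoint ranges.\<close>
  have "seqf p = seqf q"
    using dich
  proof
    assume le: "\<forall>i j. i < j \<longrightarrow> m (r i) (r j) = r i"
    have ev: "\<forall>\<^sub>F j in sequentially. m (r i) (r (2 * j)) = r i"
      "\<forall>\<^sub>F j in sequentially. m (r i) (r (2 * j + 1)) = r i" for i
      by (rule eventually_sequentiallyI[of "Suc i"]; use le in simp)+
    have "op (seqf p) (seqf p) = seqf p" "op (seqf p) (seqf q) = seqf p"
      "op (seqf q) (seqf q) = seqf q" "op (seqf q) (seqf p) = seqf q"
      by (rule seqf_mult_left; use X ev in \<open>simp add: p_def q_def\<close>)+
    then show ?thesis using ic[unfolded idempotents_commute_def, rule_format, OF seqf_filter seqf_filter, of p q]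
      by simp
  next
    assume le: "\<forall>i j. i < j \<longrightarrow> m (r i) (r j) = r j"
    have ev: "\<forall>\<^sub>F j in sequentially. m (r i) (r (2 * j)) = r (2 * j)"
      "\<forall>\<^sub>F j in sequentially. m (r i) (r (2 * j + 1)) = r (2 * j + 1)" for i
      by (rule eventually_sequentiallyI[of "Suc i"]; use le in simp)+
    have "op (seqf p) (seqf p) = seqf p" "op (seqf p) (seqf q) = seqf q"
      "op (seqf q) (seqf q) = seqf q" "op (seqf q) (seqf p) = seqf p"
      by (rule seqf_mult_right; use X ev in \<open>simp add: p_def q_def\<close>)+
    then show ?thesis using ic[unfolded idempotents_commute_def, rule_format, OF seqf_filter seqf_filter, of p q]
      by simp
  qed
  moreover have "range p \<in> seqf p" using X by (auto simp: lift_def eventually_filtermap)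
  ultimately have "range p \<in> seqf q" by simp
  then obtain n where "q n \<in> range p"
    by (force simp: lift_def eventually_filtermap eventually_sequentially)
  then obtain k where "r (2 * n + 1) = r (2 * k)" unfolding p_def q_def by auto
  then have "2 * n + 1 = 2 * k" using r by (blast dest: injD)
  then show False by presburger
qed

section \<open>Maximal subgroups\<close>

text \<open>For idempotent e this is the group of units of the monoid e X e, the largest subgroup of
  X with identity e.\<close>

definition units :: "'a \<Rightarrow> 'a set" where
  "units e = {z \<in> X. m e z = z \<and> m z e = z \<and>
     (\<exists>w\<in>X. m e w = w \<and> m w e = w \<and> m z w = e \<and> m w z = e)}"

lemma units_subgroup:
  assumes e: "e \<in> X" "m e e = e"
  shows "is_subgroup_on (units e) m" "e \<in> units e" "units e \<subseteq> X"
proof -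
  show "e \<in> units e" using e unfolding units_def by blast
  moreover have "m a b \<in> units e" if "a \<in> units e" "b \<in> units e" for a b
  proof -
    obtain a' b' where a: "a \<in> X" "m e a = a" "m a e = a" "a' \<in> X" "m e a' = a'" "m a' e = a'"
      "m a a' = e" "m a' a = e"
      and b: "b \<in> X" "m e b = b" "m b e = b" "b' \<in> X" "m e b' = b'" "m b' e = b'"
      "m b b' = e" "m b' b = e" using \<open>a \<in> units e\<close> \<open>b \<in> units e\<close> unfolding units_def by auto
    have i: "m (m a b) (m b' a') = m a (m (m b b') a')" "m (m b' a') (m a b) = m b' (m (m a' a) b)"
      using a(1,4) b(1,4) by (simp_all add: as cl)
    have j: "m e (m a b) = m a b" "m (m a b) e = m a b" "m e (m b' a') = m b' a'" "m (m b' a') e = m b' a'"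
      using as[of e a b] as[of a b e] as[of e b' a'] as[of b' a' e] a b e by simp_all
    have k: "m (m a b) (m b' a') = e" "m (m b' a') (m a b) = e"
      unfolding i by (simp_all add: a b)
    have "m a b \<in> X" "m b' a' \<in> X" using a(1,4) b(1,4) cl by auto
    then show ?thesis
      unfolding units_def using j k by blast
  qed
  moreover have "\<exists>w\<in>units e. m z w = e \<and> m w z = e" if "z \<in> units e" for z
    using that unfolding units_def by blast
  ultimately show "is_subgroup_on (units e) m"
    unfolding is_subgroup_on_def by (auto simp: units_def)
  show "units e \<subseteq> X" unfolding units_def by blast
qed

lemma C_n_2: "C_n 2 = {1, -1}"
  unfolding C_n_def by (auto simp: power2_eq_1_iff)

end

section \<open>Classification of X\<close>

locale sg_classify = sg +
  assumes ic: "idempotents_commute (filters X) op"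
    and K: "cancel_sets \<or> regular_sets"
    and reg: "x \<in> X \<Longrightarrow> \<exists>y\<in>X. m (m x y) x = x"
begin

lemma idem_comm: "e \<in> idem \<Longrightarrow> f \<in> idem \<Longrightarrow> m e f = m f e"
  using idempotents_commute_elements[OF ic, of e f] by (simp add: idem_def)

lemma idem_chain: "e \<in> idem \<Longrightarrow> f \<in> idem \<Longrightarrow> m e f = e \<or> m e f = f"
  using idempotents_chain[OF K, of e f] idem_comm[of e f] by (simp add: idem_def)

lemma idem_finite: "finite idem"
  by (rule finite_idem[OF ic idem_chain])

text \<open>\<open>g \<mapsto> x g y\<close> embeds the idempotents below \<open>y x\<close> into those below \<open>x y\<close>.\<close>

lemma idem_le_finite_eq:
  assumes x: "x \<in> X" and y: "y \<in> X" and xyx: "m (m x y) x = x" and yxy: "m (m y x) y = y"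
    and le: "m (m x y) (m y x) = m x y"
  shows "m x y = m y x"
proof -
  let ?e = "m x y" and ?f = "m y x"
  have eX: "?e \<in> X" and fX: "?f \<in> X" using x y cl by auto
  have e: "?e \<in> idem" using as[of ?e x y] x y xyx cl unfolding idem_def by auto
  have f: "?f \<in> idem" using as[of ?f y x] x y yxy cl unfolding idem_def by auto
  have fe: "m ?f ?e = ?e" using idem_comm[OF e f] le by simp
  define \<phi> where "\<phi> g = m x (m g y)" for g
  let ?De = "{g \<in> idem. m ?e g = g}"
  let ?Df = "{g \<in> idem. m ?f g = g}"
  have sub: "?De \<subseteq> ?Df"
  proof
    fix g assume g: "g \<in> ?De"
    then have "m ?f g = m (m ?f ?e) g" using as[OF fX eX, of g] unfolding idem_def by auto
    then show "g \<in> ?Df" using fe g by auto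
  qed
  have phi_inv: "m y (m (\<phi> g) x) = g" if "g \<in> ?Df" for g
  proof -
    have gX: "g \<in> X" and g: "m ?f g = g" "m g ?f = g" using that idem_comm[OF _ f] unfolding idem_def by auto
    have "m y (m (\<phi> g) x) = m ?f (m g ?f)" unfolding \<phi>_def using gX x y by (simp add: as cl)
    then show ?thesis using g by simp
  qed
  have "inj_on \<phi> ?Df" using phi_inv by (metis (no_types, lifting) inj_onI)
  moreover have "\<phi> ` ?Df \<subseteq> ?De"
  proof
    fix u assume "u \<in> \<phi> ` ?Df"
    then obtain g where g: "g \<in> ?Df" and u: "u = \<phi> g" by blast
    have gX: "g \<in> X" and gg: "m g g = g" "m ?f g = g" using g unfolding idem_def by auto
    have "m (\<phi> g) (\<phi> g) = m x (m g (m (m ?f g) y))" unfolding \<phi>_def using gX x y by (simp add: as cl)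
    also have "\<dots> = m x (m (m g g) y)" using gg as[OF gX gX y] by simp
    also have "\<dots> = \<phi> g" using gg unfolding \<phi>_def by simp
    finally have "m (\<phi> g) (\<phi> g) = \<phi> g" .
    moreover have "m ?e (\<phi> g) = \<phi> g"
      using as[OF eX x, of "m g y"] xyx cl[OF gX y] unfolding \<phi>_def by simp
    moreover have "\<phi> g \<in> X" unfolding \<phi>_def using gX x y cl by auto
    ultimately show "u \<in> ?De" unfolding u idem_def by auto
  qed
  \<comment> \<open>A finite set embedded into its own subset equals that subset. Thus
    \<open>?f\<close> is in \<open>?De\<close>, which means e f = f, while \<open>le\<close> says e
    f = e.\<close>
  ultimately have "card ?Df \<le> card ?De" using idem_finite by (intro card_inj_on_le) auto
  then have "?De = ?Df" using sub idem_finite by (intro card_seteq) auto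
  moreover have "?f \<in> ?Df" using f unfolding idem_def by auto
  ultimately have "m ?e ?f = ?f" by blast
  then show ?thesis using le by simp
qed

lemma chain_iso:
  assumes C: "C \<subseteq> idem"
  shows "\<exists>h. bij_betw h C {..<card C} \<and> (\<forall>e\<in>C. \<forall>f\<in>C. h (m e f) = min (h e) (h f))"
proof -
  have fin: "finite C" using C idem_finite by (rule finite_subset)
  let ?D = "\<lambda>e. {g \<in> C. m g e = g \<and> g \<noteq> e}"
  define h where "h e = card (?D e)" for e \<comment> \<open>the rank of \<open>e\<close> in the chain\<close>
  have mono: "h e < h f" if e: "e \<in> C" and f: "f \<in> C" and "m e f = e" "e \<noteq> f" for e f
  proof -
    have "m g f = g \<and> g \<noteq> f" if g: "g \<in> ?D e" for g
    proof -
      have X: "g \<in> X" "e \<in> X" "f \<in> X" using g e f C unfolding idem_def by auto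
      have 1: "m g e = g" "g \<noteq> e" using g by auto
      have "m g f = m g (m e f)" using as[OF X] 1 by simp
      then have "m g f = g" using 1 \<open>m e f = e\<close> by simp
      moreover have "e \<in> idem" "f \<in> idem" using e f C by auto
      then have "g \<noteq> f" using 1 \<open>m e f = e\<close> idem_comm[of e f] by auto
      ultimately show ?thesis by blast
    qed
    then have "?D e \<subset> ?D f" using that by blast
    then show ?thesis unfolding h_def using fin by (intro psubset_card_mono) auto
  qed
  have tri: "e = f \<or> h e < h f \<and> m e f = e \<or> h f < h e \<and> m e f = f"
    if "e \<in> C" "f \<in> C" for e f
  proof -
    have "e \<in> idem" "f \<in> idem" using that C by auto
    then have "m e f = e \<or> m f e = f" "m e f = m f e" using idem_chain[of e f] idem_comm[of e f] by auto
    then show ?thesis using mono[of e f] mono[of f e] that by auto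
  qed
  have inj: "inj_on h C" using tri by (metis inj_onI less_irrefl)
  have sub: "h ` C \<subseteq> {..<card C}"
  proof
    fix k assume "k \<in> h ` C"
    then obtain e where e: "e \<in> C" "k = h e" by blast
    have "?D e \<subset> C" using e by blast
    then show "k \<in> {..<card C}" using e fin unfolding h_def by (auto intro: psubset_card_mono)
  qed
  have "h ` C = {..<card C}"
    by (rule card_subset_eq[OF _ sub]) (simp_all add: card_image[OF inj])
  moreover have "h (m e f) = min (h e) (h f)" if "e \<in> C" "f \<in> C" for e f
  proof -
    have "m e e = e" using that C unfolding idem_def by blast
    then show ?thesis using tri[OF that] by auto
  qed
  ultimately show ?thesis using inj unfolding bij_betw_def by blast
qed

text \<open>For an inverse y of x the idempotents x y and y x are comparable, hence equal by
  \<open>idem_le_finite_eq\<close>. So x lies in the group of units at e = x y, which has at most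
  one element besides e; this makes x x equal to e.\<close>

lemma square_idem:
  assumes x: "x \<in> X"
  shows "m x x \<in> idem" "m (m x x) x = x" "m x (m x x) = x"
proof -
  obtain y where y: "y \<in> X" "m (m x y) x = x" "m (m y x) y = y"
    using regular_element_inverse[OF x reg[OF x]] by blast
  have e: "m x y \<in> idem" using as[of "m x y" x y] x y(1,2) cl unfolding idem_def by auto
  have f: "m y x \<in> idem" using as[of "m y x" y x] x y(1,3) cl unfolding idem_def by auto
  have xy: "m y x = m x y"
    using idem_chain[OF e f]
  proof
    assume "m (m x y) (m y x) = m x y"
    from idem_le_finite_eq[OF x y this] show ?thesis by (rule sym)
  next
    assume "m (m x y) (m y x) = m y x"
    then have "m (m y x) (m x y) = m y x" using idem_comm[OF e f] by simp
    from idem_le_finite_eq[OF y(1) x y(3,2) this] show ?thesis .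
  qed
  define e where "e = m x y"
  have eX: "e \<in> X" "m e e = e" using e unfolding e_def idem_def by auto
  have xy: "m x y = e" "m y x = e" using xy unfolding e_def by simp_all
  have ex: "m e x = x" "m x e = x" using y(1,2) x xy as[of x y x] by simp_all
  have ey: "m e y = y" "m y e = y" using y(1,3) x xy as[of y x y] by simp_all
  have xU: "x \<in> units e" unfolding units_def using x y(1) ex ey xy by blast
  note U = units_subgroup[OF eX]
  have "m x x = e"
  proof (cases "x = e")
    case True
    then show ?thesis using eX by simp
  next
    case False
    have "m x x \<in> units e" using U(1)[unfolded is_subgroup_on_def] xU by simp
    moreover have "m x x \<noteq> x"
    proof
      assume "m x x = x"
      then have "m x e = e" using as[of x x y] x y(1) xy by metis
      then show False using ex False by metis
    qed
    ultimately show ?thesis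
      using subgroup_nonidentity_unique[OF K U(3,1,2) eX(2) xU False, of "m x x"] by metis
  qed
  then show "m x x \<in> idem" "m (m x x) x = x" "m x (m x x) = x"
    using ex eX by (simp_all add: idem_def)
qed

lemma square_top:
  assumes x: "x \<in> X" "x \<notin> idem" and f: "f \<in> idem"
  shows "m (m x x) f = f" "m f (m x x) = f"
proof -
  note xx = square_idem[OF x(1)]
  have ne: "m x x \<noteq> x" using x unfolding idem_def by auto
  have fX: "f \<in> X" "m f f = f" using f unfolding idem_def by auto
  have "m x x = f" if "m (m x x) f = m x x"
    by (rule nonidempotent_top[OF K x(1) ne xx(2) fX that]) (use that idem_comm[OF f xx(1)] in simp)
  then show "m (m x x) f = f" using idem_chain[OF xx(1) f] fX by auto
  then show "m f (m x x) = f" using idem_comm[OF f xx(1)] by simp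
qed

text \<open>By \<open>square_top\<close> both squares are the largest idempotent, so x and y are
  nonidentity elements of the same subgroup.\<close>

lemma nonidempotent_unique:
  assumes x: "x \<in> X" "x \<notin> idem" and y: "y \<in> X" "y \<notin> idem"
  shows "x = y"
proof -
  note xx = square_idem[OF x(1)] and yy = square_idem[OF y(1)]
  have eq: "m y y = m x x" using square_top[OF x yy(1)] square_top[OF y xx(1)] by simp
  have e: "m x x \<in> X" "m (m x x) (m x x) = m x x" using xx unfolding idem_def by auto
  have "x \<in> units (m x x)" unfolding units_def using xx x by blast
  moreover have "y \<in> units (m x x)" unfolding units_def using yy y eq by auto
  moreover have "x \<noteq> m x x" "y \<noteq> m x x" using xx x y by auto
  moreover note U = units_subgroup[OF e]
  ultimately show ?thesis
    using subgroup_nonidentity_unique[OF K U(3,1,2) e(2), of x y] by simp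
qed

text \<open>As x is the only nonidempotent and x c is not x, the product x c is idempotent and
  commutes with c. From c = x (x c) follows c (x c) = c, while (x c) c = x c. The product c x is
  treated symmetrically.\<close>

lemma nonidempotent_mult_idem:
  assumes x: "x \<in> X" "x \<notin> idem" and c: "c \<in> idem" "c \<noteq> m x x"
  shows "m x c = c" "m c x = c"
proof -
  define f where "f = m x x"
  have cX: "c \<in> X" "m c c = c" using c unfolding idem_def by auto
  have fc: "m f c = c" "m c f = c" using square_top[OF x c(1)] unfolding f_def by auto
  have f: "m f x = x" "m x f = x" using square_idem[OF x(1)] unfolding f_def by auto
  \<comment> \<open>Multiplying x c = x by x on the left would give f c = f, hence c = f.\<close>
  have 1: "m x c \<noteq> x"
  proof
    assume "m x c = x"
    then have "m f c = f" using as[of x x c] x cX unfolding f_def by simp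
    then show False using fc c unfolding f_def by simp
  qed
  have 2: "m c x \<noteq> x"
  proof
    assume "m c x = x"
    then have "m c f = f" using as[of c x x] x cX unfolding f_def by simp
    then show False using fc c unfolding f_def by simp
  qed
  have i1: "m x c \<in> idem" using nonidempotent_unique[OF _ _ x] 1 cl[OF x(1) cX(1)] by blast
  have i2: "m c x \<in> idem" using nonidempotent_unique[OF _ _ x] 2 cl[OF cX(1) x(1)] by blast
  have xxc: "m x (m x c) = c" using as[of x x c] x cX fc unfolding f_def by simp
  have cxx: "m (m c x) x = c" using as[of c x x] x cX fc unfolding f_def by simp
  have "m c (m x c) = m (m x (m x c)) (m x c)" using xxc by simp
  also have "\<dots> = m x (m x c)"
    using as[of x "m x c" "m x c"] i1 x unfolding idem_def by simp
  finally have "m c (m x c) = c" using xxc by simp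
  moreover have "m (m x c) c = m x c" using as[of x c c] x cX by simp
  ultimately show "m x c = c" using idem_comm[OF i1 c(1)] by simp
  have "m (m c x) c = m (m c x) (m (m c x) x)" using cxx by simp
  also have "\<dots> = m (m (m c x) (m c x)) x"
    using as[of "m c x" "m c x" x] i2 x unfolding idem_def by simp
  also have "\<dots> = m (m c x) x" using i2 unfolding idem_def by simp
  finally have "m (m c x) c = c" using cxx by simp
  moreover have "m c (m c x) = m c x" using as[of c c x] x cX by simp
  ultimately show "m c x = c" using idem_comm[OF i2 c(1)] by simp
qed

text \<open>A nonidempotent x forms with its square f a copy of C_2, and the other idempotents form
  a chain C below it. If C is empty, this is the ordered union of \<open>L_n 0\<close> with C_2,
  that is C_2 itself.\<close>

lemma classification:
  "(\<exists>n::nat. sg_iso X m (L_n n) min) \<or>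
    (\<exists>n::nat. sg_iso X m (ord_union_carrier (L_n n) (C_n 2)) (ord_union_op min (*)))"
proof (cases "X \<subseteq> idem")
  case True
  then have "X = idem" unfolding idem_def by blast
  with chain_iso[of X] obtain h
    where "bij_betw h X {..<card X}" "\<forall>e\<in>X. \<forall>f\<in>X. h (m e f) = min (h e) (h f)"
    by blast
  then show ?thesis unfolding sg_iso_def L_n_def by blast
next
  case False
  then obtain x where x: "x \<in> X" "x \<notin> idem" by blast
  define f where "f = m x x"
  have f: "f \<in> idem" "m f x = x" "m x f = x" using square_idem[OF x(1)] unfolding f_def by auto
  have xx: "m x x = f" by (simp add: f_def)
  have fx: "f \<noteq> x" using f(1) x(2) by metis
  define C where "C = idem - {f}"
  have fX: "f \<in> X" "m f f = f" using f unfolding idem_def by auto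
  have CI: "c \<in> idem" if "c \<in> C" for c using that unfolding C_def by simp
  have X: "X = C \<union> {f, x}"
  proof
    show "X \<subseteq> C \<union> {f, x}" using nonidempotent_unique[OF _ _ x] unfolding C_def by blast
    show "C \<union> {f, x} \<subseteq> X" using x(1) fX(1) unfolding C_def idem_def by blast
  qed
  have nC: "x \<notin> C" "f \<notin> C" using x unfolding C_def by auto
  have fc: "m f c = c" "m c f = c" if "c \<in> C" for c
    using square_top[OF x CI[OF that]] unfolding f_def by auto
  have xc: "m x c = c" "m c x = c" if "c \<in> C" for c
    using nonidempotent_mult_idem[OF x] that unfolding C_def f_def by auto
  have "C \<subseteq> idem" unfolding C_def by auto
  from chain_iso[OF this] obtain h where h: "bij_betw h C {..<card C}"
    and hm: "\<forall>a\<in>C. \<forall>b\<in>C. h (m a b) = min (h a) (h b)"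
    by blast
  have hm: "h (m a b) = min (h a) (h b)" if "a \<in> C" "b \<in> C" for a b
    using hm that by blast
  have mC: "m a b \<in> C" if "a \<in> C" "b \<in> C" for a b
    using idem_chain[OF CI[OF that(1)] CI[OF that(2)]] that by auto
  define k :: "'a \<Rightarrow> nat + complex" where
    "k z = (if z \<in> C then Inl (h z) else if z = f then Inr 1 else Inr (-1))" for z
  have kC: "k c = Inl (h c)" if "c \<in> C" for c using that unfolding k_def by simp
  have kf: "k f = Inr 1" "k x = Inr (-1)" using nC fx unfolding k_def by auto
  have inj: "inj_on h C" and img: "h ` C = {..<card C}" using h unfolding bij_betw_def by auto
  have "bij_betw k X (ord_union_carrier (L_n (card C)) (C_n 2))"
    unfolding bij_betw_def
  proof
    have "inj_on k C" using inj by (auto simp: inj_on_def kC)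
    then show "inj_on k X" unfolding X using nC by (auto simp: kC kf)
    have "k ` C = Inl ` h ` C" using kC by (auto simp: image_iff)
    then show "k ` X = ord_union_carrier (L_n (card C)) (C_n 2)"
      unfolding X ord_union_carrier_def L_n_def C_n_2 img[symmetric] by (auto simp: kf)
  qed
  moreover have "k (m a b) = ord_union_op min (*) (k a) (k b)" if "a \<in> X" "b \<in> X" for a b
    using that unfolding X by (auto simp: kC kf mC hm fc xc f fX xx)
  ultimately show ?thesis unfolding sg_iso_def by blast
qed

end

section \<open>From the listed semigroups back to commutative Clifford filters\<close>

context sg
begin

text \<open>A member A of least cardinality is contained in every other member B, since the member A
  \<inter> B cannot be smaller.\<close>

lemma principal_filter_if_finite:
  assumes fin: "finite X" and F: "F \<in> filters X" and ne: "F \<noteq> {}"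
  shows "\<exists>A. A \<subseteq> X \<and> A \<noteq> {} \<and> F = pr A"
proof -
  have u: "F \<in> upfamilies X" using F filters_subset_upfamilies by blast
  obtain A where A: "A \<in> F" and min: "\<And>B. B \<in> F \<Longrightarrow> card A \<le> card B"
    using ex_has_least_nat[of "\<lambda>A. A \<in> F" _ card] ne by (metis ex_in_conv)
  have AX: "A \<subseteq> X" "A \<noteq> {}" using upfamiliesD(1,2)[OF u A] by simp_all
  have "A \<subseteq> B" if "B \<in> F" for B
  proof -
    have "A \<inter> B \<in> F" using F A that unfolding filters_def by blast
    then have "A \<inter> B = A" using min fin AX by (intro card_seteq) (auto intro: finite_subset)
    then show ?thesis by blast
  qed
  then have "F \<subseteq> pr A"
    using upfamiliesD(1)[OF u] by (auto simp: lift_def eventually_principal)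
  moreover have "pr A \<subseteq> F"
    using upfamiliesD(3)[OF u A] by (auto simp: lift_def eventually_principal)
  ultimately have "F = pr A" by (rule subset_antisym)
  then show ?thesis using AX by blast
qed

lemma op_empty:
  assumes "F \<in> filters X"
  shows "op {} F = {}" "op F {} = {}"
proof -
  have "F \<in> upfamilies X" using assms filters_subset_upfamilies by blast
  from upfamiliesD(2)[OF this] show "op F {} = {}" by (auto simp: ext_op_def)
qed (simp add: ext_op_def)

text \<open>The law \<open>triple\<close> gives A A A \<subseteq> A, and its instance x x x = x
  gives the converse. So each F = F F F lies in the group {F, F F} with identity F F; the empty
  family is a one-element group.\<close>

lemma commutative_clifford_filters:
  assumes fin: "finite X" and comm: "\<And>x y. x \<in> X \<Longrightarrow> y \<in> X \<Longrightarrow> m x y = m y x"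
    and triple: "\<And>x y z. x \<in> X \<Longrightarrow> y \<in> X \<Longrightarrow> z \<in> X \<Longrightarrow> m x (m y z) \<in> {x, y, z}"
  shows "commutative_on (filters X) op \<and> clifford_on (filters X) op"
proof
  note dec = principal_filter_if_finite[OF fin]
  have "sprod m A B \<subseteq> sprod m B A" if A: "A \<subseteq> X" and B: "B \<subseteq> X" for A B
  proof
    fix u assume "u \<in> sprod m A B"
    then obtain a b where ab: "a \<in> A" "b \<in> B" "u = m a b" unfolding sprod_def by blast
    then have "u = m b a" using comm[of a b] A B by auto
    then show "u \<in> sprod m B A" using ab unfolding sprod_def by blast
  qed
  then have sc: "sprod m A B = sprod m B A" if "A \<subseteq> X" "B \<subseteq> X" for A B
    using that by (metis subset_antisym)
  show "commutative_on (filters X) op"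
    unfolding commutative_on_def
  proof (intro ballI)
    fix F G assume F: "F \<in> filters X" and G: "G \<in> filters X"
    show "op F G = op G F"
    proof (cases "F = {} \<or> G = {}")
      case True
      then show ?thesis using op_empty F G by auto
    next
      case False
      then have "F \<noteq> {}" "G \<noteq> {}" by simp_all
      obtain A where A: "A \<subseteq> X" "A \<noteq> {}" "F = pr A" using dec[OF F \<open>F \<noteq> {}\<close>] by iprover
      obtain B where B: "B \<subseteq> X" "B \<noteq> {}" "G = pr B" using dec[OF G \<open>G \<noteq> {}\<close>] by iprover
      from A B show ?thesis using sc[of A B] by (simp add: pr_mult)
    qed
  qed
  show "clifford_on (filters X) op"
    unfolding clifford_on_def
  proof
    fix F assume F: "F \<in> filters X"
    show "\<exists>G\<subseteq>filters X. F \<in> G \<and> is_subgroup_on G op"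
    proof (cases "F = {}")
      case True
      then have "op F F = F" using op_empty(1)[OF F] by simp
      then have "is_subgroup_on {F} op" by (simp add: is_subgroup_on_def)
      moreover have "{F} \<subseteq> filters X" "F \<in> {F}" using F by simp_all
      ultimately show ?thesis by iprover
    next
      case False
      then obtain A where A: "A \<subseteq> X" "A \<noteq> {}" and FA: "F = pr A"
        using dec[OF F False] by iprover
      have "sprod m A (sprod m A A) = A"
      proof
        show "sprod m A (sprod m A A) \<subseteq> A"
        proof
          fix u assume "u \<in> sprod m A (sprod m A A)"
          then obtain x y z where u: "x \<in> A" "y \<in> A" "z \<in> A" "u = m x (m y z)"
            unfolding sprod_def by blast
          then have "u \<in> {x, y, z}" using triple[of x y z] A by blast
          then show "u \<in> A" using u(1-3) by blast
        qed
        show "A \<subseteq> sprod m A (sprod m A A)"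
        proof
          fix x assume x: "x \<in> A"
          then have "x \<in> X" using A by blast
          then have "x = m x (m x x)" using triple[of x x x] by simp
          then show "x \<in> sprod m A (sprod m A A)" using x unfolding sprod_def by blast
        qed
      qed
      then have F3: "op F (op F F) = F" using A by (simp add: FA pr_mult sprod_sub sprod_ne)
      have FF: "op F F \<in> filters X" using ext_op_filters F by blast
      have F3': "op (op F F) F = F" using F3 sgD(2)[OF semigroup_filters F F F] by simp
      have F4: "op (op F F) (op F F) = op F F" using F3 sgD(2)[OF semigroup_filters F F FF] by simp
      have "is_subgroup_on {F, op F F} op"
        unfolding is_subgroup_on_def by (simp add: F3 F3' F4)
      moreover have "{F, op F F} \<subseteq> filters X" "F \<in> {F, op F F}" using F FF by simp_all
      ultimately show ?thesis by iprover
    qed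
  qed
qed

text \<open>Finiteness and both laws pull back along the isomorphism, which leaves only concrete
  multiplication tables to check.\<close>

lemma commutative_clifford_if_iso:
  assumes iso: "sg_iso X m T n" and fin: "finite T"
    and comm: "\<And>x y. x \<in> T \<Longrightarrow> y \<in> T \<Longrightarrow> n x y = n y x"
    and triple: "\<And>x y z. x \<in> T \<Longrightarrow> y \<in> T \<Longrightarrow> z \<in> T \<Longrightarrow> n x (n y z) \<in> {x, y, z}"
  shows "commutative_on (filters X) op \<and> clifford_on (filters X) op"
proof -
  obtain h where h: "bij_betw h X T" "\<And>x y. x \<in> X \<Longrightarrow> y \<in> X \<Longrightarrow> h (m x y) = n (h x) (h y)"
    using iso unfolding sg_iso_def by blast
  have hT: "h x \<in> T" if "x \<in> X" for x using h(1) that unfolding bij_betw_def by blast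
  have inj: "x = y" if "h x = h y" "x \<in> X" "y \<in> X" for x y
    using h(1) that unfolding bij_betw_def inj_on_def by blast
  show ?thesis
  proof (rule commutative_clifford_filters)
    show "finite X" using h(1) fin bij_betw_finite by blast
    show "m x y = m y x" if "x \<in> X" "y \<in> X" for x y
      by (rule inj) (simp_all add: that h(2) cl comm[OF hT[OF that(1)] hT[OF that(2)]])
    show "m x (m y z) \<in> {x, y, z}" if "x \<in> X" "y \<in> X" "z \<in> X" for x y z
    proof -
      have "h (m x (m y z)) \<in> {h x, h y, h z}"
        using triple[OF hT[OF that(1)] hT[OF that(2)] hT[OF that(3)]] by (simp add: h(2) that cl)
      moreover have "m x (m y z) \<in> X" using that cl by simp
      ultimately show ?thesis using inj[of "m x (m y z)" x] inj[of "m x (m y z)" y]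
          inj[of "m x (m y z)" z] that by blast
    qed
  qed
qed

end

section \<open>The cycle of implications\<close>

theorem theorem1p2:
  fixes X :: "'a set" and m :: "'a \<Rightarrow> 'a \<Rightarrow> 'a"
  assumes "semigroup_on X m"
  shows "((commutative_on (filters X) (ext_op X m) \<and> clifford_on (filters X) (ext_op X m))
            \<longleftrightarrow> inverse_on (filters X) (ext_op X m))
       \<and> (inverse_on (filters X) (ext_op X m)
            \<longleftrightarrow> (idempotents_commute (filters X) (ext_op X m) \<and>
                 (sub_clifford_on (filters X) (ext_op X m) \<or>
                  regular_in (filters X) (linked_upfamilies X) (ext_op X m))))
       \<and> ((idempotents_commute (filters X) (ext_op X m) \<and>
                 (sub_clifford_on (filters X) (ext_op X m) \<or>
                  regular_in (filters X) (linked_upfamilies X) (ext_op X m)))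
            \<longleftrightarrow> (sg_iso X m (C_n 2) (*) \<or>
                 (\<exists>n::nat. sg_iso X m (L_n n) min) \<or>
                 (\<exists>n::nat. sg_iso X m (ord_union_carrier (L_n n) (C_n 2)) (ord_union_op min (*)))))"
    (is "(?c1 \<longleftrightarrow> ?c2) \<and> (_ \<longleftrightarrow> ?c3) \<and> (_ \<longleftrightarrow> ?c4)")
proof -
  interpret sg X m using assms by unfold_locales
  have cycle: "(P \<longleftrightarrow> Q) \<and> (Q \<longleftrightarrow> R) \<and> (R \<longleftrightarrow> S)"
    if "P \<Longrightarrow> Q" "Q \<Longrightarrow> R" "R \<Longrightarrow> S" "S \<Longrightarrow> P" for P Q R S
    using that by blast
  show ?thesis
  proof (rule cycle)
    assume ?c1
    then show ?c2 using commutative_clifford_imp_inverse[OF semigroup_filters] by simp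
  next
    assume inv: ?c2
    \<comment> \<open>An inverse found among the filters is in particular a linked upfamily, so (2)
      leads to the regularity alternative of (3).\<close>
    have "regular_in (filters X) (linked_upfamilies X) op"
      unfolding regular_in_def
    proof
      fix F assume "F \<in> filters X"
      from inv[unfolded inverse_on_def, rule_format, OF this]
      obtain G where "G \<in> filters X" "op (op F G) F = F" by (elim ex1E conjE)
      then show "\<exists>G\<in>linked_upfamilies X. op (op F G) F = F"
        using filters_subset_linked by (intro bexI[of _ G]) auto
    qed
    then show ?c3 using inverse_imp_idempotents_commute[OF semigroup_filters inv] by simp
  next
    assume c3: ?c3
    have "sg_classify X m"
    proof
      show "idempotents_commute (filters X) op" using c3 by (rule conjunct1)
      from c3 have "sub_clifford_on (filters X) op \<or> regular_in (filters X) (linked_upfamilies X) op"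
        by (rule conjunct2)
      then have K: "sub_clifford_on (filters X) op \<or> regular_sets" using regular_sets_if_regular_in by iprover
      then show "cancel_sets \<or> regular_sets" using cancel_sets_if_sub_clifford by iprover
      show "\<exists>y\<in>X. m (m x y) x = x" if "x \<in> X" for x
        using K regular_element_if_sub_clifford[OF _ that] regular_element_if_regular_sets[OF _ that]
        by iprover
    qed
    then show ?c4 by (rule disjI2[OF sg_classify.classification])
  next
    assume c4: ?c4
    from c4 show ?c1
    proof (elim disjE exE)
      assume "sg_iso X m (C_n 2) (*)"
      then show ?thesis by (rule commutative_clifford_if_iso) (auto simp: C_n_2)
    next
      fix n :: nat assume "sg_iso X m (L_n n) min"
      then show ?thesis by (rule commutative_clifford_if_iso) (auto simp: L_n_def min_def)
    next
      fix n :: nat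
      assume "sg_iso X m (ord_union_carrier (L_n n) (C_n 2)) (ord_union_op min (*))"
      then show ?thesis
        by (rule commutative_clifford_if_iso)
          (auto simp: ord_union_carrier_def C_n_2 L_n_def min_def split: if_splits)
    qed
  qed
qed

end
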